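(* Fix $0<\varepsilon<1/10$. Let $x$ be large, let $xe^{-(1/2-\varepsilon)\sqrt{\log x}}\le y\le x$, and let $q$ be a positive integer such that $$\Big(\frac{x^2}{y^2}(\log x)^{3/2}\Big)^{1+\varepsilon}\le q\le xe^{-\frac32\sqrt{\log x}}.$$ Put $\alpha=a/q$ where $(a,q)=1$. Then there exists a multiplicative function $f:\mathbb{N}\to\mathbb{U}$ such that $$\Big|\sum_{\substack{n\le x\\ P^+(n)\le y}} f(n)e(n\alpha)\Big|\gg\frac{\sqrt{xy}}{\log x}.$$
   Context: $\mathbb{U}=\{z\in\mathbb{C}:|z|\le1\}$ and $e(t)=\exp(2\pi i t)$. $P^+(n)$ is the largest prime factor of $n$, with $P^+(1)=1$. The implied constant is positive and depends at most on $\varepsilon$. *)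

theory Defs
  imports "HOL-Analysis.Analysis" "HOL-Computational_Algebra.Primes"
begin

definition unit_disc :: "complex set"
  where "unit_disc = {z. norm z \<le> 1}"

definition e :: "real \<Rightarrow> complex"
  where "e t = exp (2 * of_real pi * \<i> * of_real t)"

(* The value at 0 is a convention that plays no role: only positive integers matter. *)
definition largest_prime_factor :: "nat \<Rightarrow> nat"
  where "largest_prime_factor n = (if n \<le> 1 then 1 else Max (prime_factors n))"

(* Arithmetic functions live on the positive integers; f 0 is unconstrained. *)
definition multiplicative :: "(nat \<Rightarrow> complex) \<Rightarrow> bool"
  where "multiplicative f \<longleftrightarrow>
    f 1 = 1 \<and> (\<forall>m>0. \<forall>n>0. coprime m n \<longrightarrow> f (m * n) = f m * f n)"

end

theory Submission
  imports Defs "HOL-Real_Asymp.Real_Asymp"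
begin

text \<open>
  Let \<open>P\<close> be the set of primes in \<open>(y / 8, y]\<close>. An integer \<open>n \<le> x\<close> has at most one prime factor in
  \<open>P\<close>, so the values of \<open>f\<close> on \<open>P\<close> may be used to align the contributions of the integers \<open>p * m\<close>
  for the different \<open>p \<in> P\<close> (\<open>exists_aligned_multiplicative\<close>). The norm of the whole sum is then at
  least the sum over \<open>p \<in> P\<close> of the norms of \<open>S p = (\<Sum>m\<le>x / p. g m * e (m * (p * \<alpha>)))\<close>, where \<open>g\<close> is a
  multiplicative function still to be chosen. By Chebyshev's bound \<open>P\<close> has at least
  a constant times \<open>y / ln y\<close> elements, so it suffices that \<open>S p\<close> has the order of its
  root-mean-square size \<open>sqrt (x / y)\<close> on average over \<open>p \<in> P\<close>.

  Such a \<open>g\<close> exists for every family of points \<open>\<theta> p\<close> in place of \<open>p * \<alpha>\<close>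
  (\<open>exists_multiplicative_large_on_average\<close>). Put \<open>M = 8 * (x / y)\<close>, a bound for the lengths of the sums, and let
  \<open>\<kappa>\<close> be about \<open>M\<close> to the power \<open>1 / 8\<close>. Dirichlet's theorem gives each \<open>\<theta> p\<close> a rational approximation
  with denominator at most \<open>\<kappa> ^ 7\<close>.

  If for at least half of the primes this denominator is at least \<open>\<kappa>\<close>, take \<open>g n = n ^ (i u)\<close> and average
  over \<open>u\<close>, which makes \<open>g\<close> behave like a random multiplicative function. The second moment of
  \<open>S p\<close> is its length. Expanding the square of its modulus over reduced fractions shows that the
  fourth moment is a sum of squares of geometric sums, and this sum is of order \<open>M\<^sup>2\<close> because the
  multiples of \<open>\<theta> p\<close> are well spaced (\<open>double_sum_dirichlet_le\<close>). Comparing the two moments gives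
  a first moment of order \<open>sqrt M\<close> (\<open>exists_arch_char_large\<close>).

  Otherwise at least half of the points lie on major arcs, which are covered by only about \<open>\<kappa> ^ 3\<close>
  intervals of length \<open>1 / M\<close>. Some interval contains a proportion of order \<open>1 / \<kappa> ^ 3\<close> of them, and
  a function concentrated on primes of size about \<open>x / y\<close> that resonates with this interval yields sums of order \<open>M / ln M\<close> there. The
  gain over \<open>sqrt M\<close> exceeds the loss \<open>\<kappa> ^ 3\<close> (\<open>exists_large_on_major_arcs\<close>).
\<close>

section \<open>Chebyshev's lower bound for primes\<close>

text \<open>
  In the Leibniz harmonic triangle \<open>1 / (m * (n choose m))\<close>, the entry at \<open>(n, m + 1)\<close> is the entry
  at \<open>(n - 1, m)\<close> minus the entry at \<open>(n, m)\<close>. Every entry is therefore an integer combination of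
  the reciprocals \<open>1 / k\<close> with \<open>k \<le> n\<close>, and multiplication by \<open>L\<close> makes it an integer.
\<close>

lemma mult_choose_dvd:
  fixes L n m :: nat
  assumes "1 \<le> m" "m \<le> n" and L: "\<And>k. 1 \<le> k \<Longrightarrow> k \<le> n \<Longrightarrow> k dvd L"
  shows "m * (n choose m) dvd L"
proof -
  have "real L / (real m * real (n choose m)) \<in> \<int>"
    using assms
  proof (induction m arbitrary: n rule: nat_induct_at_least)
    case base
    then have "n dvd L" by auto
    then show ?case by (auto elim!: dvdE)
  next
    case (Suc m)
    obtain n' where n: "n = Suc n'" using Suc.prems by (cases n) auto
    have m: "m \<ge> 1" "m \<le> n'" using Suc.hyps Suc.prems n by auto
    have I1: "real L / (real m * real (n' choose m)) \<in> \<int>"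
      by (rule Suc.IH) (use Suc.prems n m in auto)
    have I2: "real L / (real m * real (n choose m)) \<in> \<int>"
      by (rule Suc.IH) (use Suc.prems n m in auto)
    have pos: "n' choose m > 0" "n choose m > 0" "n choose Suc m > 0"
      using m n Suc.prems by (auto simp: zero_less_binomial_iff simp del: binomial_Suc_Suc)
    have e1: "real (Suc m) * real (n choose Suc m) = real n * real (n' choose m)"
      using Suc_times_binomial_eq[of n' m] n by (metis mult.commute of_nat_mult)
    have "(n - m) * (n choose m) = n * (n' choose m)"
      using binomial_absorb_comp[of n m] n by simp
    then have "real (n - m) * real (n choose m) = real n * real (n' choose m)"
      by (metis of_nat_mult)
    then have e2: "(real n - real m) * real (n choose m) = real n * real (n' choose m)"
      using m n by (simp add: of_nat_diff)
    define A B where "A = real (n' choose m)" and "B = real (n choose m)"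
    have AB: "A > 0" "B > 0" "(real n - real m) * B = real n * A" using pos e2 by (auto simp: A_def B_def)
    have "real L / (real (Suc m) * real (n choose Suc m))
      = real L / (real m * A) - real L / (real m * B)"
    proof -
      have "1 / (real m * A) - 1 / (real m * B) = (B - A) / (real m * A * B)"
        using AB m by (simp add: field_simps)
      also have "real n * (B - A) = real m * B" using AB(3) by (simp add: algebra_simps)
      then have "B - A = real m * B / real n" using n by (simp add: field_simps)
      then have "(B - A) / (real m * A * B) = 1 / (real n * A)"
        using AB m by simp
      finally have "real L * (1 / (real m * A) - 1 / (real m * B)) = real L * (1 / (real n * A))"
        by simp
      then show ?thesis unfolding e1 A_def[symmetric] by (simp add: algebra_simps)
    qed
    then show ?case using I1 I2 by (simp add: A_def B_def)
  qed
  then obtain z where "real L / (real m * real (n choose m)) = of_int z" by (auto elim: Ints_cases)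
  moreover have "n choose m > 0" using assms by simp
  ultimately have "real L = of_int z * (real m * real (n choose m))"
    using assms by (simp add: field_simps)
  then have "int L = z * int (m * (n choose m))"
    by (metis (mono_tags, lifting) of_int_eq_iff of_int_mult of_int_of_nat_eq of_nat_mult)
  then have "int (m * (n choose m)) dvd int L" by simp
  then show ?thesis by (simp only: of_nat_dvd_iff)
qed

lemma prime_power_dvd_Lcm:
  fixes p :: nat
  assumes "finite A" "prime p" "v > 0" "0 \<notin> A" "p ^ v dvd Lcm A"
  shows "\<exists>a\<in>A. p ^ v dvd a"
  using assms
proof (induction A rule: finite_induct)
  case empty
  then show ?case using prime_gt_1_nat[of p] by simp
next
  case (insert a A)
  have nz: "a \<noteq> 0" "Lcm A \<noteq> 0" using insert.prems insert.hyps by (auto simp: Lcm_0_iff)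
  have "v \<le> multiplicity p (lcm a (Lcm A))"
    using insert.prems nz by (intro multiplicity_geI) (auto simp: lcm_eq_0_iff)
  also have "\<dots> = max (multiplicity p a) (multiplicity p (Lcm A))"
    using nz insert.prems by (intro multiplicity_lcm) auto
  finally have "v \<le> multiplicity p a \<or> v \<le> multiplicity p (Lcm A)" by linarith
  then have "p ^ v dvd a \<or> p ^ v dvd Lcm A" using multiplicity_dvd' by blast
  then show ?case using insert by auto
qed

text \<open>
  A prime power dividing \<open>n choose m\<close> divides the least common multiple of \<open>1, \<dots>, n\<close>, hence
  divides a single number up to \<open>n\<close>.
\<close>

lemma prime_power_dvd_choose_le:
  fixes p n m :: nat
  assumes "prime p" "v > 0" "1 \<le> m" "m \<le> n" "p ^ v dvd (n choose m)"
  shows "p ^ v \<le> n"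
proof -
  have "m * (n choose m) dvd Lcm {1..n}" using assms by (intro mult_choose_dvd) auto
  then have "p ^ v dvd Lcm {1..n}" using assms(5) by (meson dvd_mult_right dvd_trans dvd_triv_right)
  then obtain a where "a \<in> {1..n}" "p ^ v dvd a" using prime_power_dvd_Lcm[of "{1..n}" p v] assms by auto
  then show ?thesis using dvd_imp_le[of "p^v" a] by auto
qed

text \<open>
  Erdos's argument: for \<open>n = 2 m + 1\<close> the primes in \<open>(m + 1, n]\<close> all divide \<open>n choose m\<close>, which is
  at most \<open>4 ^ m\<close> because it occurs twice in a row of Pascal's triangle with sum \<open>2 * 4 ^ m\<close>.
\<close>

lemma primorial_le: "\<Prod>{p::nat. prime p \<and> p \<le> n} \<le> 4 ^ n"
proof (induction n rule: less_induct)
  case (less n)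
  consider "n \<le> 1" | "n = 2" | m where "n = 2 * m" "m \<ge> 2" | m where "n = 2 * m + 1" "m \<ge> 1"
  proof -
    have "n \<le> 1 \<or> n = 2 \<or> (\<exists>m. n = 2 * m \<and> m \<ge> 2) \<or> (\<exists>m. n = 2 * m + 1 \<and> m \<ge> 1)"
      by presburger
    then show thesis using that by blast
  qed
  then show ?case
  proof cases
    case 1
    then have "{p::nat. prime p \<and> p \<le> n} = {}" by (auto dest!: prime_gt_1_nat)
    then show ?thesis by (simp only: prod.empty) simp
  next
    case 2
    have "{p::nat. prime p \<and> p \<le> 2} = {2}" by (auto intro: le_antisym prime_ge_2_nat)
    then show ?thesis using 2 by simp
  next
    case (3 m)
    have "\<not> prime n" using 3 prime_product[of 2 m] by auto
    then have "p \<le> n \<longleftrightarrow> p \<le> n - 1" if "prime p" for p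
      using that 3 by (cases "p = n") auto
    then have "{p::nat. prime p \<and> p \<le> n} = {p. prime p \<and> p \<le> n - 1}"
      by blast
    then have "\<Prod>{p::nat. prime p \<and> p \<le> n} \<le> 4 ^ (n - 1)" using less.IH[of "n - 1"] 3 by simp
    also have "\<dots> \<le> 4 ^ n" by (intro power_increasing) auto
    finally show ?thesis .
  next
    case (4 m)
    define D where "D = {p::nat. prime p \<and> m + 1 < p \<and> p \<le> n}"
    have fin: "finite D" by (rule finite_subset[of _ "{..n}"]) (auto simp: D_def)
    have prime_D: "\<And>p. p \<in> D \<Longrightarrow> prime p" by (simp add: D_def)
    have dv: "p dvd (n choose m)" if "p \<in> D" for p
    proof -
      have p: "prime p" "m + 1 < p" "p \<le> n" using that by (auto simp: D_def)
      have "p dvd fact n" using p by (simp add: prime_dvd_fact_iff)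
      moreover have "fact n = fact m * fact (n - m) * (n choose m)"
        using binomial_fact_lemma[of m n] 4 by simp
      moreover have "\<not> p dvd fact m" "\<not> p dvd fact (n - m)"
        using p 4 by (simp_all add: prime_dvd_fact_iff del: fact_Suc)
      ultimately show ?thesis using p(1) by (metis prime_dvd_mult_iff)
    qed
    have "\<Prod>D dvd (n choose m)"
      using fin dv prime_D
    proof (induction D rule: finite_induct)
      case empty then show ?case by simp
    next
      case (insert p D)
      have "coprime p (\<Prod>D)"
      proof (rule prod_coprime_right)
        fix q assume "q \<in> D"
        then show "coprime p q" using insert.hyps insert.prems by (intro primes_coprime) auto
      qed
      then show ?case using insert by (simp add: divides_mult)
    qed
    then have "\<Prod>D \<le> (n choose m)" using 4 by (intro dvd_imp_le) auto
    also have "\<dots> \<le> 4 ^ m"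
    proof -
      have "2 * (n choose m) = (n choose m) + (n choose (m + 1))"
        using binomial_symmetric[of m n] 4 by simp
      also have "\<dots> = (\<Sum>k\<in>{m, m + 1}. n choose k)" by simp
      also have "\<dots> \<le> (\<Sum>k\<le>n. n choose k)" using 4 by (intro sum_mono2) auto
      also have "\<dots> = 2 * 4 ^ m" using 4 by (simp only: choose_row_sum) (simp add: power_mult)
      finally show ?thesis by simp
    qed
    finally have D: "\<Prod>D \<le> 4 ^ m" .
    have "{p::nat. prime p \<and> p \<le> n} = {p. prime p \<and> p \<le> m + 1} \<union> D"
      using 4 by (auto simp: D_def)
    moreover have "{p. prime p \<and> p \<le> m + 1} \<inter> D = {}" by (auto simp: D_def)
    moreover have "finite {p::nat. prime p \<and> p \<le> m + 1}" by (rule finite_subset[of _ "{..m+1}"]) auto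
    ultimately have "\<Prod>{p::nat. prime p \<and> p \<le> n} = \<Prod>{p. prime p \<and> p \<le> m + 1} * \<Prod>D"
      using fin by (simp add: prod.union_disjoint)
    also have "\<dots> \<le> 4 ^ (m + 1) * 4 ^ m" using less.IH[of "m+1"] 4 D by (intro mult_mono) auto
    also have "\<dots> = 4 ^ n" using 4 by (simp flip: power_add)
    finally show ?thesis .
  qed
qed

text \<open>
  Factor \<open>2 n choose n \<ge> 4 ^ n / (2 n)\<close> into prime powers, each at most \<open>2 n\<close>. The primes up to
  \<open>sqrt (2 n)\<close> are few; larger ones occur to the first power, so those up to \<open>n / 2\<close>
  contribute at most the primorial \<open>4 ^ (n / 2) \<le> 2 ^ n\<close>. The remaining factor \<open>2 ^ n\<close>, up to
  lower-order terms, must come from primes in \<open>(n / 2, 2 n]\<close>.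
\<close>

lemma primes_between_ge:
  fixes n :: nat
  assumes "n \<ge> 1"
  shows "real n * ln 2 \<le> (1 + sqrt (2 * n) + card {p. prime p \<and> n div 2 < p \<and> p \<le> 2 * n}) * ln (2 * n)"
proof -
  define C where "C = (2 * n) choose n"
  have C0: "C > 0" by (simp add: C_def)
  define A where "A = {p \<in> prime_factors C. p ^ 2 \<le> 2 * n}"
  define B where "B = {p \<in> prime_factors C. p ^ 2 > 2 * n \<and> p \<le> n div 2}"
  define D where "D = {p \<in> prime_factors C. p ^ 2 > 2 * n \<and> p > n div 2}"
  define P where "P = {p. prime p \<and> n div 2 < p \<and> p \<le> 2 * n}"
  have fin: "finite A" "finite B" "finite D" by (auto simp: A_def B_def D_def)
  have finP: "finite P" by (rule finite_subset[of _ "{..2 * n}"]) (auto simp: P_def)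
  have pow: "p ^ multiplicity p C \<le> 2 * n" if "p \<in> prime_factors C" for p
    using that assms C0 prime_power_dvd_choose_le[of p "multiplicity p C" n "2 * n"]
    by (auto simp: C_def multiplicity_dvd prime_factors_multiplicity)
  have mult_pos: "multiplicity p C \<ge> 1" if "p \<in> prime_factors C" for p
    using that by (auto simp: prime_factors_multiplicity)
  have sub: "A \<subseteq> {1..nat \<lfloor>sqrt (2 * n)\<rfloor>}"
  proof
    fix p assume p: "p \<in> A"
    then have "p ^ 2 \<le> 2 * n" by (simp add: A_def)
    then have "real (p ^ 2) \<le> real (2 * n)" by (simp only: of_nat_le_iff)
    then have "real p ^ 2 \<le> 2 * n" by simp
    then have "real p \<le> sqrt (2 * n)" by (rule real_le_rsqrt)
    moreover have "p \<ge> 1" using p prime_ge_1_nat[of p] by (auto simp: A_def prime_factors_multiplicity)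
    ultimately show "p \<in> {1..nat \<lfloor>sqrt (2 * n)\<rfloor>}" by (simp add: le_nat_floor)
  qed
  have "card A \<le> nat \<lfloor>sqrt (2 * n)\<rfloor>" using card_mono[OF _ sub] by simp
  then have "real (card A) \<le> real (nat \<lfloor>sqrt (2 * n)\<rfloor>)" by linarith
  also have "\<dots> \<le> sqrt (2 * n)" by (rule of_nat_floor) simp
  finally have cA: "real (card A) \<le> sqrt (2 * n)" .
  have cD: "card D \<le> card P"
  proof (intro card_mono finP subsetI)
    fix p assume p: "p \<in> D"
    then have "p ^ 1 \<le> p ^ multiplicity p C"
      by (intro power_increasing) (auto simp: D_def mult_pos prime_factors_multiplicity prime_ge_1_nat)
    then show "p \<in> P" using p pow[of p] by (auto simp: D_def P_def)
  qed
  have "C = (\<Prod>p\<in>prime_factors C. p ^ multiplicity p C)"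
    using C0 by (intro prime_factorization_nat)
  also have "prime_factors C = A \<union> B \<union> D" by (auto simp: A_def B_def D_def)
  also have "(\<Prod>p\<in>A \<union> B \<union> D. p ^ multiplicity p C) =
      (\<Prod>p\<in>A. p ^ multiplicity p C) * (\<Prod>p\<in>B. p ^ multiplicity p C) * (\<Prod>p\<in>D. p ^ multiplicity p C)"
  proof -
    have "A \<inter> B = {}" "(A \<union> B) \<inter> D = {}" by (auto simp: A_def B_def D_def)
    then show ?thesis using fin by (simp add: prod.union_disjoint)
  qed
  also have "\<dots> \<le> (2 * n) ^ card A * 4 ^ (n div 2) * (2 * n) ^ card D"
  proof (intro mult_mono)
    show "(\<Prod>p\<in>A. p ^ multiplicity p C) \<le> (2 * n) ^ card A"
      by (intro prod_le_power) (use pow assms in \<open>auto simp: A_def\<close>)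
    show "(\<Prod>p\<in>D. p ^ multiplicity p C) \<le> (2 * n) ^ card D"
      by (intro prod_le_power) (use pow assms in \<open>auto simp: D_def\<close>)
    have "multiplicity p C = 1" if "p \<in> B" for p
    proof (rule ccontr)
      assume "multiplicity p C \<noteq> 1"
      then have "multiplicity p C \<ge> 2" using mult_pos[of p] that by (auto simp: B_def)
      then have "p ^ 2 \<le> p ^ multiplicity p C"
        using that prime_ge_1_nat[of p]
        by (intro power_increasing) (auto simp: B_def prime_factors_multiplicity)
      then show False using pow[of p] that by (auto simp: B_def)
    qed
    then have "(\<Prod>p\<in>B. p ^ multiplicity p C) = \<Prod>B" by simp
    also have "\<dots> \<le> \<Prod>{p. prime p \<and> p \<le> n div 2}"
    proof (rule dvd_imp_le)
      have "finite {p. prime p \<and> p \<le> n div 2}" by (rule finite_subset[of _ "{..n div 2}"]) auto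
      then show "\<Prod>B dvd \<Prod>{p. prime p \<and> p \<le> n div 2}"
        by (rule prod_dvd_prod_subset) (auto simp: B_def)
      show "0 < \<Prod>{p::nat. prime p \<and> p \<le> n div 2}"
        by (intro prod_pos) (auto simp: prime_gt_0_nat)
    qed
    also have "\<dots> \<le> 4 ^ (n div 2)" by (rule primorial_le)
    finally show "(\<Prod>p\<in>B. p ^ multiplicity p C) \<le> 4 ^ (n div 2)" .
  qed auto
  also have "4 ^ (n div 2) \<le> (2::nat) ^ n"
    using power_increasing[of "2 * (n div 2)" n "2::nat"] by (simp add: power_mult)
  finally have C_le: "C \<le> (2 * n) ^ card A * 2 ^ n * (2 * n) ^ card D" by simp
  have "real (4 ^ n) \<le> real (C * (2 * n))"
    using central_binomial_lower_bound[of n] assms by (simp add: C_def field_simps)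
  then have "4 ^ n \<le> C * (2 * n)" by (simp only: of_nat_le_iff)
  also have "\<dots> \<le> ((2 * n) ^ card A * 2 ^ n * (2 * n) ^ card D) * (2 * n)"
    using C_le by (intro mult_right_mono) auto
  also have "\<dots> = 2 ^ n * (2 * n) ^ (1 + card A + card D)" by (simp add: power_add)
  also have "(4::nat) ^ n = 2 ^ n * 2 ^ n" by (simp flip: power_mult_distrib)
  finally have "2 ^ n \<le> (2 * n) ^ (1 + card A + card D)" by simp
  then have "real (2 ^ n) \<le> real ((2 * n) ^ (1 + card A + card D))" by (simp only: of_nat_le_iff)
  then have "ln (real (2 ^ n)) \<le> ln (real ((2 * n) ^ (1 + card A + card D)))"
    using assms by (subst ln_le_cancel_iff) auto
  moreover have "ln (real (2 ^ n)) = real n * ln 2" by (simp add: ln_realpow)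
  moreover have "ln (real ((2 * n) ^ (1 + card A + card D))) = real (1 + card A + card D) * ln (2 * n)"
    using assms by (simp only: of_nat_power) (subst ln_realpow, auto)
  ultimately have "real n * ln 2 \<le> real (1 + card A + card D) * ln (2 * n)" by simp
  also have "\<dots> \<le> (1 + sqrt (2 * n) + card P) * ln (2 * n)"
    using cA cD assms by (intro mult_right_mono) auto
  finally show ?thesis by (simp add: P_def)
qed

text \<open>
  Chebyshev's lower bound, localised to a bounded ratio: the primes that serve as large prime factors
  have to be comparable with \<open>y\<close>, so that the cofactors \<open>m \<le> x / p\<close> run over ranges of comparable
  length.
\<close>

lemma card_primes_ge:
  "\<exists>c>0. \<forall>\<^sub>F y::real in at_top. card {p::nat. prime p \<and> y / 8 < p \<and> p \<le> y} \<ge> c * y / ln y"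
proof (intro exI[of _ "1/10"] conjI)
  have "\<forall>\<^sub>F y::real in at_top. y / 4 * (1 / 2) - (1 + sqrt y) * ln y \<ge> 1 / 10 * y"
    by real_asymp
  then show "\<forall>\<^sub>F y::real in at_top. card {p::nat. prime p \<and> y / 8 < p \<and> p \<le> y} \<ge> (1/10) * y / ln y"
    using eventually_ge_at_top[of 4]
  proof eventually_elim
    case (elim y)
    define n where "n = nat \<lfloor>y / 2\<rfloor>"
    have n: "real n \<le> y / 2" "real n > y / 2 - 1" using elim by (auto simp: n_def) linarith+
    have n1: "n \<ge> 1" using n elim by (cases n) auto
    let ?A = "{p. prime p \<and> n div 2 < p \<and> p \<le> 2 * n}"
    let ?B = "{p::nat. prime p \<and> y / 8 < p \<and> p \<le> y}"
    have fin: "finite ?B" by (rule finite_subset[of _ "{..nat \<lfloor>y\<rfloor>}"]) (auto simp: le_nat_floor)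
    have "?A \<subseteq> ?B"
    proof safe
      fix p assume "prime p" "n div 2 < p" "p \<le> 2 * n"
      have "n + 1 \<le> 2 * p" using \<open>n div 2 < p\<close> by linarith
      then have "real n + 1 \<le> 2 * real p" by linarith
      then show "y / 8 < real p" using n elim by linarith
      show "real p \<le> y" using \<open>p \<le> 2 * n\<close> n by linarith
    qed
    then have c: "card ?A \<le> card ?B" using fin by (rule card_mono[rotated])
    have ly: "ln y > 0" using elim by simp
    have "y / 4 * (1 / 2) \<le> real n * ln 2" using n elim ln2_ge_two_thirds by (intro mult_mono) auto
    also have "\<dots> \<le> (1 + sqrt (2 * n) + card ?A) * ln (2 * n)" using primes_between_ge[OF n1] .
    also have "\<dots> \<le> (1 + sqrt y + card ?B) * ln y"
      using n n1 c elim by (intro mult_mono add_mono) (auto simp: ln_mono)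
    finally have "1 / 10 * y \<le> card ?B * ln y" using elim by (simp add: algebra_simps)
    then show ?case using ly by (simp add: field_simps)
  qed
qed simp

section \<open>Geometric sums at multiples of a point\<close>

lemma norm_e [simp]: "norm (e t) = 1"
  unfolding e_def by (metis norm_exp_i_times mult.commute mult.left_commute of_real_mult of_real_numeral)

lemma e_0 [simp]: "e 0 = 1"
  by (simp add: e_def)

lemma e_add: "e (s + t) = e s * e t"
  by (simp add: e_def algebra_simps exp_add)

lemma e_of_int [simp]: "e (of_int k) = 1"
proof -
  have "e (of_int k) = exp (\<i> * (of_int k * (of_real pi * 2)))"
    by (simp add: e_def mult_ac)
  then show ?thesis by simp
qed

lemma e_add_int: "e (t + of_int k) = e t"
  by (simp add: e_add)

lemma e_minus: "e (- t) = cnj (e t)"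
  by (simp add: e_def exp_cnj)

lemma e_of_nat_mult: "e (real n * t) = e t ^ n"
  by (simp add: e_def algebra_simps flip: exp_of_nat_mult)

text \<open>
  The sharp constant is 4. The constant 2 is enough to bound geometric sums by the reciprocal of
  the distance to the nearest integer, and it follows from the cubic Taylor bound for the sine.
\<close>

lemma norm_e_minus_1_ge:
  assumes "\<bar>t\<bar> \<le> 1 / 2"
  shows "norm (e t - 1) \<ge> 2 * \<bar>t\<bar>"
proof -
  define u where "u = pi * \<bar>t\<bar>"
  have u: "0 \<le> u" "u \<le> 2"
    using assms mult_mono[of pi 4 "\<bar>t\<bar>" "1/2"] pi_less_4 by (auto simp: u_def)
  have "\<bar>sin u - (\<Sum>m<3. sin_coeff m * u ^ m)\<bar> \<le> inverse (fact 3) * \<bar>u\<bar> ^ 3"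
    by (rule Maclaurin_sin_bound)
  then have "6 * \<bar>sin u - u\<bar> \<le> u ^ 3"
    using u by (simp add: numeral_3_eq_3 sin_coeff_def fact_numeral field_simps)
  then have "sin u \<ge> u - u ^ 3 / 6"
    by (simp add: abs_if split: if_splits)
  moreover have "u ^ 3 \<le> 4 * u"
    using u mult_mono[of u 2 u 2] mult_right_mono[of "u*u" 4 u] by (simp add: power3_eq_cube)
  ultimately have "sin u \<ge> u / 3" by simp
  also have "u / 3 \<ge> \<bar>t\<bar>" using pi_gt3 mult_right_mono[of 3 pi "\<bar>t\<bar>"] by (simp add: u_def)
  finally have "\<bar>t\<bar> \<le> \<bar>sin u\<bar>" by simp
  also have "\<bar>sin u\<bar> = \<bar>sin (2 * pi * t / 2)\<bar>" by (cases "t \<ge> 0") (auto simp: u_def)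
  finally show ?thesis using dist_exp_i_1[of "2 * pi * t"] by (simp add: e_def mult_ac)
qed

definition dirichlet_sum :: "nat \<Rightarrow> real \<Rightarrow> complex"
  where "dirichlet_sum L t = (\<Sum>a=1..L. e (real a * t))"

definition int_dist :: "real \<Rightarrow> real"
  where "int_dist t = \<bar>t - of_int (round t)\<bar>"

lemma int_dist_le_half: "int_dist t \<le> 1 / 2"
  using of_int_round_abs_le[of t] by (simp add: int_dist_def abs_minus_commute)

lemma int_dist_le: "int_dist t \<le> \<bar>t - of_int k\<bar>"
  using round_diff_minimal[of t k] by (simp add: int_dist_def abs_minus_commute)

text \<open>
  The sum is at most \<open>Y\<close> trivially and at most \<open>1 / int_dist t\<close> as a geometric series. The smooth
  majorant combines the two bounds in a form whose sums over separated points telescope.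
\<close>

lemma norm_dirichlet_sum_le:
  assumes "real L \<le> Y"
  shows "norm (dirichlet_sum L t) ^ 2 \<le> 4 * Y\<^sup>2 / (1 + Y * int_dist t)\<^sup>2"
proof -
  define d where "d = int_dist t"
  define s where "s = t - of_int (round t)"
  have d: "d = \<bar>s\<bar>" "d \<ge> 0" by (auto simp: d_def s_def int_dist_def)
  have Y: "Y \<ge> 0" using assms by linarith
  have es: "e t = e s"
    using e_add_int[of s "round t"] by (simp add: s_def)
  have le1: "norm (dirichlet_sum L t) \<le> Y"
  proof -
    have "norm (dirichlet_sum L t) \<le> (\<Sum>a=1..L. norm (e (real a * t)))"
      unfolding dirichlet_sum_def by (rule norm_sum)
    then show ?thesis using assms by simp
  qed
  have le2: "norm (dirichlet_sum L t) * d \<le> 1"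
  proof -
    have "dirichlet_sum L t = (\<Sum>a=1..L. e t ^ a)" by (simp add: dirichlet_sum_def e_of_nat_mult)
    also have "\<dots> = e t * (\<Sum>a<L. e t ^ a)"
      by (simp add: sum_distrib_left sum.atLeast1_atMost_eq)
    finally have "dirichlet_sum L t * (e t - 1) = e t * (e t ^ L - 1)"
      using power_diff_1_eq[of "e t" L] by (simp add: mult_ac)
    then have "norm (dirichlet_sum L t) * norm (e t - 1) = norm (e t ^ L - 1)"
      by (metis mult_1 norm_e norm_mult)
    also have "\<dots> \<le> norm (e t ^ L) + norm (1::complex)" by (rule norm_triangle_ineq4)
    also have "\<dots> = 2" by (simp add: norm_power)
    finally have "norm (dirichlet_sum L t) * norm (e t - 1) \<le> 2" .
    moreover have "norm (e t - 1) \<ge> 2 * d"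
      unfolding es d(1) using int_dist_le_half[of t] d by (intro norm_e_minus_1_ge) (simp add: d_def)
    ultimately show ?thesis
      using mult_left_mono[of "2 * d" "norm (e t - 1)" "norm (dirichlet_sum L t)"] by simp
  qed
  have pos: "1 + Y * d > 0" using Y d by (simp add: add_pos_nonneg)
  have "norm (dirichlet_sum L t) * (1 + Y * d) \<le> 2 * Y"
    using le1 mult_left_mono[OF le2 Y] by (simp add: algebra_simps)
  then have "norm (dirichlet_sum L t) \<le> 2 * Y / (1 + Y * d)" using pos by (simp add: field_simps)
  then have "norm (dirichlet_sum L t) ^ 2 \<le> (2 * Y / (1 + Y * d)) ^ 2" by (intro power_mono) auto
  then show ?thesis by (simp add: power_divide power_mult_distrib d_def)
qed

text \<open>
  Compare each term after the first with
  \<open>Y\<^sup>2 / ((1 + Y * ((j - 1) * \<delta>)) * (1 + Y * (j * \<delta>)))\<close>, which telescopes.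
\<close>

lemma sum_inverse_square_progression:
  fixes Y \<delta> :: real
  assumes "Y > 0" "\<delta> > 0"
  shows "(\<Sum>j\<le>n. Y\<^sup>2 / (1 + Y * (real j * \<delta>))\<^sup>2) \<le> Y\<^sup>2 + Y / \<delta>"
proof -
  have "(\<Sum>j\<le>n. Y\<^sup>2 / (1 + Y * (real j * \<delta>))\<^sup>2) \<le> Y\<^sup>2 + Y / \<delta> * (1 - 1 / (1 + Y * (real n * \<delta>)))"
  proof (induction n)
    case (Suc n)
    define A where "A = 1 + Y * (real n * \<delta>)"
    have A: "A \<ge> 1" using assms by (simp add: A_def)
    have B: "1 + Y * (real (Suc n) * \<delta>) = A + Y * \<delta>" by (simp add: A_def algebra_simps)
    have pos: "Y * \<delta> > 0" using assms by simp
    have "Y\<^sup>2 / (A + Y * \<delta>)\<^sup>2 \<le> Y\<^sup>2 / (A * (A + Y * \<delta>))"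
      using A pos by (intro divide_left_mono) (auto simp: power2_eq_square intro!: mult_right_mono mult_pos_pos)
    also have "\<dots> = Y / \<delta> * (1 / A - 1 / (A + Y * \<delta>))"
    proof -
      have "A \<noteq> 0" "A + Y * \<delta> \<noteq> 0" using A pos by linarith+
      then show ?thesis using assms by (simp add: divide_simps) (simp add: algebra_simps power2_eq_square)
    qed
    finally show ?case using Suc.IH unfolding sum.atMost_Suc B A_def[symmetric]
      by (simp add: algebra_simps)
  qed simp
  also have "\<dots> \<le> Y\<^sup>2 + Y / \<delta>"
    using assms mult_left_mono[of "1 - 1 / (1 + Y * (real n * \<delta>))" 1 "Y / \<delta>"] by simp
  finally show ?thesis .
qed

lemma sum_separated_nonneg:
  fixes g :: "'a \<Rightarrow> real" and Y \<delta> :: real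
  assumes "finite K" "Y > 0" "\<delta> > 0" "\<And>k. k \<in> K \<Longrightarrow> g k \<ge> 0"
    and sep: "\<And>k l. k \<in> K \<Longrightarrow> l \<in> K \<Longrightarrow> k \<noteq> l \<Longrightarrow> \<bar>g k - g l\<bar> \<ge> \<delta>"
  shows "(\<Sum>k\<in>K. Y\<^sup>2 / (1 + Y * g k)\<^sup>2) \<le> Y\<^sup>2 + Y / \<delta>"
proof -
  define j where "j k = nat \<lfloor>g k / \<delta>\<rfloor>" for k
  have j: "real (j k) * \<delta> \<le> g k" "g k < (real (j k) + 1) * \<delta>" if "k \<in> K" for k
  proof -
    have "real (j k) = of_int \<lfloor>g k / \<delta>\<rfloor>" using assms(3,4) that by (simp add: j_def)
    then have "real (j k) \<le> g k / \<delta>" "g k / \<delta> < real (j k) + 1" by linarith+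
    then show "real (j k) * \<delta> \<le> g k" "g k < (real (j k) + 1) * \<delta>"
      using assms(3) by (simp_all add: field_simps)
  qed
  have inj: "inj_on j K"
  proof (rule inj_onI, rule ccontr)
    fix k l assume kl: "k \<in> K" "l \<in> K" "j k = j l" "k \<noteq> l"
    show False using sep[OF kl(1,2,4)] j[OF kl(1)] j[OF kl(2)] kl(3)
      by (simp add: algebra_simps abs_le_iff split: abs_split)
  qed
  obtain n where n: "j ` K \<subseteq> {..n}" using assms(1) by (meson finite_imageI finite_nat_iff_bounded_le)
  have "(\<Sum>k\<in>K. Y\<^sup>2 / (1 + Y * g k)\<^sup>2) \<le> (\<Sum>k\<in>K. Y\<^sup>2 / (1 + Y * (real (j k) * \<delta>))\<^sup>2)"
  proof (intro sum_mono divide_left_mono)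
    fix k assume k: "k \<in> K"
    have nn: "1 + Y * (real (j k) * \<delta>) > 0" using assms by (simp add: add_pos_nonneg)
    have le: "1 + Y * (real (j k) * \<delta>) \<le> 1 + Y * g k"
      using j[OF k] assms by (simp add: mult_left_mono)
    then show "(1 + Y * (real (j k) * \<delta>))\<^sup>2 \<le> (1 + Y * g k)\<^sup>2" using nn by (intro power_mono) auto
    show "0 < (1 + Y * g k)\<^sup>2 * (1 + Y * (real (j k) * \<delta>))\<^sup>2" using nn le by simp
  qed simp
  also have "\<dots> = (\<Sum>i\<in>j ` K. Y\<^sup>2 / (1 + Y * (real i * \<delta>))\<^sup>2)" by (simp add: sum.reindex[OF inj])
  also have "\<dots> \<le> (\<Sum>i\<le>n. Y\<^sup>2 / (1 + Y * (real i * \<delta>))\<^sup>2)" using n by (intro sum_mono2) auto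
  also have "\<dots> \<le> Y\<^sup>2 + Y / \<delta>" by (rule sum_inverse_square_progression) fact+
  finally show ?thesis .
qed

text \<open>
  Points that are pairwise \<open>\<delta>\<close>-separated modulo 1 behave like two progressions with
  step \<open>\<delta>\<close>, one on each side of the nearest integers.
\<close>

lemma sum_separated:
  fixes t :: "'a \<Rightarrow> real" and Y \<delta> :: real
  assumes "finite K" "Y > 0" "\<delta> > 0"
    and sep: "\<And>k l. k \<in> K \<Longrightarrow> l \<in> K \<Longrightarrow> k \<noteq> l \<Longrightarrow> int_dist (t k - t l) \<ge> \<delta>"
  shows "(\<Sum>k\<in>K. 4 * Y\<^sup>2 / (1 + Y * int_dist (t k))\<^sup>2) \<le> 8 * (Y\<^sup>2 + Y / \<delta>)"
proof -
  define g where "g k = t k - of_int (round (t k))" for k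
  have g: "int_dist (t k) = \<bar>g k\<bar>" for k by (simp add: g_def int_dist_def)
  have sep': "\<bar>g k - g l\<bar> \<ge> \<delta>" if "k \<in> K" "l \<in> K" "k \<noteq> l" for k l
    using sep[OF that] int_dist_le[of "t k - t l" "round (t k) - round (t l)"]
    by (simp add: g_def algebra_simps)
  define K1 K2 where "K1 = {k\<in>K. g k \<ge> 0}" and "K2 = {k\<in>K. g k < 0}"
  have "(\<Sum>k\<in>K. Y\<^sup>2 / (1 + Y * \<bar>g k\<bar>)\<^sup>2) =
      (\<Sum>k\<in>K1. Y\<^sup>2 / (1 + Y * \<bar>g k\<bar>)\<^sup>2) + (\<Sum>k\<in>K2. Y\<^sup>2 / (1 + Y * \<bar>g k\<bar>)\<^sup>2)"
    using assms(1) by (subst sum.union_disjoint[symmetric]) (auto simp: K1_def K2_def intro!: sum.cong)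
  also have "(\<Sum>k\<in>K1. Y\<^sup>2 / (1 + Y * \<bar>g k\<bar>)\<^sup>2) \<le> Y\<^sup>2 + Y / \<delta>"
  proof (rule sum_separated_nonneg)
    fix k l assume "k \<in> K1" "l \<in> K1" "k \<noteq> l"
    then show "\<delta> \<le> \<bar>\<bar>g k\<bar> - \<bar>g l\<bar>\<bar>" using sep'[of k l] by (auto simp: K1_def)
  qed (use assms in \<open>auto simp: K1_def\<close>)
  also have "(\<Sum>k\<in>K2. Y\<^sup>2 / (1 + Y * \<bar>g k\<bar>)\<^sup>2) \<le> Y\<^sup>2 + Y / \<delta>"
  proof (rule sum_separated_nonneg)
    fix k l assume "k \<in> K2" "l \<in> K2" "k \<noteq> l"
    then show "\<delta> \<le> \<bar>\<bar>g k\<bar> - \<bar>g l\<bar>\<bar>" using sep'[of k l] by (auto simp: K2_def)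
  qed (use assms in \<open>auto simp: K2_def\<close>)
  finally have "(\<Sum>k\<in>K. Y\<^sup>2 / (1 + Y * \<bar>g k\<bar>)\<^sup>2) \<le> 2 * (Y\<^sup>2 + Y / \<delta>)" by simp
  then have "4 * (\<Sum>k\<in>K. Y\<^sup>2 / (1 + Y * \<bar>g k\<bar>)\<^sup>2) \<le> 8 * (Y\<^sup>2 + Y / \<delta>)" by simp
  then show ?thesis by (simp add: g sum_distrib_left)
qed


lemma int_dist_minus: "int_dist (- t) = int_dist t"
proof -
  have "int_dist (- t) \<le> int_dist t" for t
    using int_dist_le[of "- t" "- round t"] by (simp add: int_dist_def[of t] abs_minus_commute)
  from this[of t] this[of "- t"] show ?thesis by simp
qed

text \<open>
  If \<open>h / r\<close> is a reduced fraction close to \<open>\<theta>\<close>, then \<open>k * h / r\<close> is at distance at least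
  \<open>1 / r\<close> from the integers, and for \<open>k \<le> r / 2\<close> the approximation error accounts for at most half
  of this distance.
\<close>

lemma int_dist_multiple_ge:
  fixes h :: int and r k :: nat
  assumes "coprime h (int r)" "\<bar>real r * \<theta> - of_int h\<bar> \<le> 1 / real r" "0 < k" "2 * k \<le> r"
  shows "int_dist (real k * \<theta>) \<ge> 1 / (2 * real r)"
proof -
  define z where "z = round (real k * \<theta>)"
  have r: "r > 0" using assms by simp
  have "int k * h - z * int r \<noteq> 0"
  proof
    assume "int k * h - z * int r = 0"
    then have "int r dvd int k * h" by (metis dvd_triv_right eq_iff_diff_eq_0)
    then have "int r dvd int k" using assms(1) by (simp add: coprime_dvd_mult_left_iff coprime_commute)
    then show False using assms(3,4) by (auto dest: dvd_imp_le)
  qed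
  then have "\<bar>int k * h - z * int r\<bar> \<ge> 1" by linarith
  then have "1 \<le> \<bar>real_of_int (int k * h - z * int r)\<bar>" by linarith
  also have "real_of_int (int k * h - z * int r) =
      real r * (real k * \<theta> - of_int z) - real k * (real r * \<theta> - of_int h)"
    by (simp add: algebra_simps)
  also have "\<bar>\<dots>\<bar> \<le> real r * int_dist (real k * \<theta>) + real k * (1 / real r)"
  proof -
    have "\<bar>real r * (real k * \<theta> - of_int z)\<bar> = real r * int_dist (real k * \<theta>)"
      by (simp add: abs_mult int_dist_def z_def)
    moreover have "\<bar>real k * (real r * \<theta> - of_int h)\<bar> \<le> real k * (1 / real r)"
      unfolding abs_mult using assms(2) by (intro mult_mono) auto
    ultimately show ?thesis by linarith
  qed
  also have "real k * (1 / real r) \<le> 1 / 2"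
  proof -
    have "2 * real k \<le> real r" using assms(4) by linarith
    then show ?thesis using r by (simp add: field_simps)
  qed
  finally show ?thesis using r by (simp add: field_simps)
qed

text \<open>
  Cut the range of \<open>k\<close> into blocks of length about \<open>r / 2\<close>. Inside a block the multiples of \<open>\<theta>\<close>
  are separated by \<open>1 / (2 r)\<close>.
\<close>

lemma sum_multiples_le:
  fixes h :: int and r b :: nat
  assumes cop: "coprime h (int r)" and app: "\<bar>real r * \<theta> - of_int h\<bar> \<le> 1 / real r"
    and r: "r > 0" and Y: "Y > 0"
  shows "(\<Sum>k=1..<b. 4 * Y\<^sup>2 / (1 + Y * int_dist (real k * \<theta>))\<^sup>2) \<le> (2 * real b / real r + 1) * (8 * (Y\<^sup>2 + 2 * real r * Y))"
proof -
  define w where "w k = 4 * Y\<^sup>2 / (1 + Y * int_dist (real k * \<theta>))\<^sup>2" for k :: nat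
  define B where "B = r div 2 + 1"
  have w: "w k \<ge> 0" for k by (simp add: w_def)
  have block: "sum w {i * B..<i * B + B} \<le> 8 * (Y\<^sup>2 + 2 * real r * Y)" for i
  proof -
    have "sum w {i * B..<i * B + B} \<le> 8 * (Y\<^sup>2 + Y / (1 / (2 * real r)))"
      unfolding w_def
    proof (rule sum_separated)
      have *: "int_dist (real k * \<theta> - real l * \<theta>) \<ge> 1 / (2 * real r)"
        if "k \<in> {i * B..<i * B + B}" "l \<in> {i * B..<i * B + B}" "l < k" for k l
      proof -
        have "k - l \<le> r div 2" using that by (auto simp: B_def)
        then have "2 * (k - l) \<le> r" by linarith
        then have "int_dist (real (k - l) * \<theta>) \<ge> 1 / (2 * real r)"
          using that by (intro int_dist_multiple_ge[OF cop app]) auto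
        then show ?thesis using that by (simp add: of_nat_diff algebra_simps)
      qed
      fix k l assume kl: "k \<in> {i * B..<i * B + B}" "l \<in> {i * B..<i * B + B}" "k \<noteq> l"
      show "int_dist (real k * \<theta> - real l * \<theta>) \<ge> 1 / (2 * real r)"
        using *[of k l] *[of l k] kl int_dist_minus[of "real k * \<theta> - real l * \<theta>"] by force
    qed (use Y r in auto)
    then show ?thesis by (simp add: mult_ac)
  qed
  define n where "n = b div B + 1"
  have "b < B + b div B * B" by (rule dividend_less_div_times) (simp add: B_def)
  then have "b < n * B" by (simp add: n_def)
  then have "sum w {1..<b} \<le> sum w {..<n * B}" using w by (intro sum_mono2) auto
  also have "\<dots> = (\<Sum>i<n. sum w {i * B..<i * B + B})" by (rule sum.nat_group[symmetric])
  also have "\<dots> \<le> (\<Sum>i<n. 8 * (Y\<^sup>2 + 2 * real r * Y))" by (intro sum_mono block)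
  also have "\<dots> = real n * (8 * (Y\<^sup>2 + 2 * real r * Y))" by simp
  also have "\<dots> \<le> (2 * real b / real r + 1) * (8 * (Y\<^sup>2 + 2 * real r * Y))"
  proof (intro mult_right_mono)
    have "real (b div B) \<le> real b / real B" by (rule of_nat_div_le_of_nat)
    also have "\<dots> \<le> real b / (real r / 2)"
    proof (intro divide_left_mono)
      have "r \<le> 2 * B" by (simp add: B_def)
      then show "real r / 2 \<le> real B" by linarith
    qed (use r in \<open>auto simp: B_def\<close>)
    finally show "real n \<le> 2 * real b / real r + 1" by (simp add: n_def field_simps)
    show "0 \<le> 8 * (Y\<^sup>2 + 2 * real r * Y)" using Y by simp
  qed
  finally show ?thesis by (simp add: w_def)
qed

lemma sum_inverse_le: "N \<ge> 1 \<Longrightarrow> (\<Sum>b=1..N. 1 / real b) \<le> 1 + ln (real N)"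
proof (induction N rule: nat_induct_at_least)
  case (Suc n)
  have "ln (real n / real (Suc n)) \<le> real n / real (Suc n) - 1"
    using Suc.hyps by (intro ln_le_minus_one) auto
  also have "\<dots> = - (1 / real (Suc n))" by (simp add: field_simps)
  also have "ln (real n / real (Suc n)) = ln (real n) - ln (real (Suc n))"
    using Suc.hyps by (simp add: ln_div)
  finally show ?case using Suc.IH by simp
qed simp

lemma sum_inverse_square_le: "(\<Sum>b=1..N. 1 / (real b)\<^sup>2) \<le> 2"
proof -
  have "(\<Sum>b=1..Suc N. 1 / (real b)\<^sup>2) \<le> 2 - 1 / real (Suc N)" for N
  proof (induction N)
    case (Suc n)
    have "1 / (real (Suc (Suc n)))\<^sup>2 \<le> 1 / (real (Suc n) * real (Suc (Suc n)))"
      by (intro divide_left_mono) (auto simp: power2_eq_square intro!: mult_right_mono)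
    also have "\<dots> = 1 / real (Suc n) - 1 / real (Suc (Suc n))" by (simp add: divide_simps)
    finally show ?case using Suc.IH unfolding sum.cl_ivl_Suc[of _ 1 "Suc n"] by simp
  qed simp
  from this[of "N - 1"] show ?thesis by (cases N) (auto intro: order_trans)
qed

text \<open>
  The off-diagonal part of the fourth moment. The four terms that \<open>sum_multiples_le\<close> produces are
  \<open>M\<^sup>2 / (b r)\<close>, \<open>M\<close>, \<open>M\<^sup>2 / b\<^sup>2\<close> and \<open>r M / b\<close>. Summing the first and the last over \<open>b\<close> costs
  a logarithm, which is at most \<open>9 \<kappa>\<close>; this is absorbed since \<open>r\<close> stays away from both ends
  of the range from 1 to \<open>M\<close>, that is \<open>\<kappa> \<le> r \<le> \<kappa> ^ 7\<close> with \<open>\<kappa>\<close> about \<open>M\<close> to the power \<open>1 / 8\<close>.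
\<close>

lemma double_sum_dirichlet_le:
  fixes h :: int and r N \<kappa> :: nat and M :: real
  assumes cop: "coprime h (int r)" and app: "\<bar>real r * \<theta> - of_int h\<bar> \<le> 1 / real r"
    and r: "\<kappa> \<le> r" "r \<le> \<kappa> ^ 7" and \<kappa>: "\<kappa> \<ge> 1" "real \<kappa> ^ 8 \<le> M" "M \<le> (real \<kappa> + 1) ^ 8"
    and N: "1 \<le> N" "real N \<le> M"
  shows "(\<Sum>b=1..N. \<Sum>k=1..<b. (norm (dirichlet_sum (N div b) (real k * \<theta>)))\<^sup>2) \<le> 336 * M\<^sup>2"
proof -
  define H1 H2 where "H1 = (\<Sum>b=1..N. 1 / real b)" and "H2 = (\<Sum>b=1..N. 1 / (real b)\<^sup>2)"
  have r0: "r > 0" and M: "M \<ge> 1" using r \<kappa> N by auto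
  have H1_0: "H1 \<ge> 0" unfolding H1_def by (intro sum_nonneg) auto
  have "ln (real N) \<le> ln ((real \<kappa> + 1) ^ 8)" using N \<kappa> by (subst ln_le_cancel_iff) auto
  also have "\<dots> = 8 * ln (1 + real \<kappa>)" using ln_realpow[of "real \<kappa> + 1" 8] by (simp add: add_ac)
  also have "\<dots> \<le> 8 * real \<kappa>" using ln_add_one_self_le_self[of "real \<kappa>"] by simp
  finally have "H1 \<le> 1 + 8 * real \<kappa>" using sum_inverse_le[of N] N by (simp add: H1_def)
  also have "\<dots> \<le> 9 * real \<kappa>" using \<kappa> by simp
  finally have H1: "H1 \<le> 9 * real \<kappa>" .
  have H2: "H2 \<le> 2" unfolding H2_def by (rule sum_inverse_square_le)
  have "(\<Sum>b=1..N. \<Sum>k=1..<b. (norm (dirichlet_sum (N div b) (real k * \<theta>)))\<^sup>2)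
      \<le> (\<Sum>b=1..N. 16 * M\<^sup>2 / real r * (1 / real b) + 32 * M + 8 * M\<^sup>2 * (1 / (real b)\<^sup>2) + 16 * real r * M * (1 / real b))"
  proof (rule sum_mono)
    fix b assume b: "b \<in> {1..N}"
    define Y where "Y = M / real b"
    have Y: "Y > 0" "real (N div b) \<le> Y"
    proof -
      have "real (N div b) \<le> real N / real b" by (rule of_nat_div_le_of_nat)
      also have "\<dots> \<le> Y" unfolding Y_def using N by (intro divide_right_mono) auto
      finally show "real (N div b) \<le> Y" .
    qed (use b M in \<open>auto simp: Y_def\<close>)
    have "(\<Sum>k=1..<b. (norm (dirichlet_sum (N div b) (real k * \<theta>)))\<^sup>2)
        \<le> (\<Sum>k=1..<b. 4 * Y\<^sup>2 / (1 + Y * int_dist (real k * \<theta>))\<^sup>2)"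
      by (intro sum_mono norm_dirichlet_sum_le Y)
    also have "\<dots> \<le> (2 * real b / real r + 1) * (8 * (Y\<^sup>2 + 2 * real r * Y))"
      by (rule sum_multiples_le[OF cop app r0 Y(1)])
    also have "\<dots> = 16 * M\<^sup>2 / real r * (1 / real b) + 32 * M + 8 * M\<^sup>2 * (1 / (real b)\<^sup>2) + 16 * real r * M * (1 / real b)"
      using b r0 by (simp add: Y_def field_simps power2_eq_square)
    finally show "(\<Sum>k=1..<b. (norm (dirichlet_sum (N div b) (real k * \<theta>)))\<^sup>2) \<le> \<dots>" .
  qed
  also have "\<dots> = 16 * M\<^sup>2 / real r * H1 + 32 * M * real N + 8 * M\<^sup>2 * H2 + 16 * real r * M * H1"
    unfolding sum.distrib H1_def H2_def sum_distrib_left by simp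
  also have "\<dots> \<le> 144 * M\<^sup>2 + 32 * M\<^sup>2 + 16 * M\<^sup>2 + 144 * M\<^sup>2"
  proof (intro add_mono)
    have "H1 / real r \<le> 9" using H1 r r0 by (simp add: field_simps)
    then have "16 * M\<^sup>2 * (H1 / real r) \<le> 16 * M\<^sup>2 * 9" by (intro mult_left_mono) auto
    then show "16 * M\<^sup>2 / real r * H1 \<le> 144 * M\<^sup>2" by simp
    show "32 * M * real N \<le> 32 * M\<^sup>2" using N M by (simp add: power2_eq_square)
    show "8 * M\<^sup>2 * H2 \<le> 16 * M\<^sup>2" using H2 mult_left_mono[of H2 2 "8 * M\<^sup>2"] by simp
    have "real r * H1 \<le> real \<kappa> ^ 7 * (9 * real \<kappa>)"
      using r H1 H1_0 by (intro mult_mono) (auto simp flip: of_nat_power)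
    also have "\<dots> = 9 * real \<kappa> ^ 8" by (simp add: power_Suc2[of _ 7, simplified] mult_ac eval_nat_numeral)
    also have "\<dots> \<le> 9 * M" using \<kappa> by simp
    finally have "16 * M * (real r * H1) \<le> 16 * M * (9 * M)" using M by (intro mult_left_mono) auto
    then show "16 * real r * M * H1 \<le> 144 * M\<^sup>2" by (simp add: power2_eq_square mult_ac)
  qed
  finally show ?thesis by simp
qed

section \<open>Moments of sums twisted by n to the power iu\<close>

lemma mean_cis:
  assumes "\<bar>\<mu>\<bar> < 2 * pi"
  shows "(\<lambda>T. (\<Sum>t<T. cis (real t * \<mu>)) / of_nat T) \<longlonglongrightarrow> (if \<mu> = 0 then 1 else 0)"
proof (cases "\<mu> = 0")
  case True
  have "\<forall>\<^sub>F T in sequentially. (\<Sum>t<T. cis (real t * \<mu>)) / of_nat T = 1"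
    using eventually_gt_at_top[of 0] by eventually_elim (simp add: True)
  then show ?thesis using True by (simp add: tendsto_eventually)
next
  case False
  have ne: "cis \<mu> \<noteq> 1"
  proof
    assume "cis \<mu> = 1"
    then obtain n :: int where "\<mu> = of_int n * (2 * pi)"
      by (auto simp: cis_conv_exp exp_eq_1)
    then show False using assms False by (cases "n = 0") (auto simp: abs_mult)
  qed
  have eq: "(\<Sum>t<T. cis (real t * \<mu>)) = (cis \<mu> ^ T - 1) / (cis \<mu> - 1)" for T
  proof -
    have "cis (real t * \<mu>) = cis \<mu> ^ t" for t by (simp add: Complex.DeMoivre)
    then show ?thesis using geometric_sum[OF ne, of T] by presburger
  qed
  have "(\<lambda>T. 2 / norm (cis \<mu> - 1) * (1 / real T)) \<longlonglongrightarrow> 2 / norm (cis \<mu> - 1) * 0"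
    by (intro tendsto_intros lim_1_over_n)
  then have lim: "(\<lambda>T. 2 / norm (cis \<mu> - 1) * (1 / real T)) \<longlonglongrightarrow> 0" by simp
  have "(\<lambda>T. (\<Sum>t<T. cis (real t * \<mu>)) / of_nat T) \<longlonglongrightarrow> 0"
  proof (rule Lim_null_comparison[OF _ lim], rule always_eventually, rule allI)
    fix T
    have "norm (cis \<mu> ^ T - 1) \<le> 2"
      using norm_triangle_ineq4[of "cis \<mu> ^ T" 1] by (simp add: norm_power)
    then have "norm (cis \<mu> ^ T - 1) / (norm (cis \<mu> - 1) * real T) \<le> 2 / (norm (cis \<mu> - 1) * real T)"
      by (intro divide_right_mono) auto
    then show "norm ((\<Sum>t<T. cis (real t * \<mu>)) / of_nat T) \<le> 2 / norm (cis \<mu> - 1) * (1 / real T)"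
      by (simp add: eq norm_divide norm_mult)
  qed
  then show ?thesis using False by simp
qed

lemma mean_trig_sum:
  assumes "finite I" "\<And>i. i \<in> I \<Longrightarrow> \<bar>\<mu> i\<bar> < 2 * pi"
  shows "(\<lambda>T. (\<Sum>t<T. \<Sum>i\<in>I. c i * cis (real t * \<mu> i)) / of_nat T)
      \<longlonglongrightarrow> (\<Sum>i\<in>I. if \<mu> i = 0 then c i else 0)"
proof -
  have "(\<lambda>T. \<Sum>i\<in>I. c i * ((\<Sum>t<T. cis (real t * \<mu> i)) / of_nat T))
      \<longlonglongrightarrow> (\<Sum>i\<in>I. c i * (if \<mu> i = 0 then 1 else 0))"
    using assms by (intro tendsto_intros mean_cis) auto
  moreover have "(\<Sum>i\<in>I. c i * ((\<Sum>t<T. cis (real t * \<mu> i)) / of_nat T)) =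
      (\<Sum>t<T. \<Sum>i\<in>I. c i * cis (real t * \<mu> i)) / of_nat T" for T
    by (subst sum.swap) (simp add: sum_distrib_left sum_divide_distrib)
  moreover have "(\<Sum>i\<in>I. c i * (if \<mu> i = 0 then 1 else 0)) = (\<Sum>i\<in>I. if \<mu> i = 0 then c i else 0)"
    by (intro sum.cong) auto
  ultimately show ?thesis by simp
qed

definition twisted_sum :: "(nat \<Rightarrow> complex) \<Rightarrow> nat \<Rightarrow> real \<Rightarrow> complex"
  where "twisted_sum g N \<theta> = (\<Sum>m=1..N. g m * e (real m * \<theta>))"

text \<open>
  The completely multiplicative function \<open>n \<mapsto> n ^ (i u)\<close>. As \<open>u\<close> varies, its values at the primes
  behave like independent random points of the unit circle, because the logarithms of distinct positive
  rationals are distinct.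
\<close>

definition arch_char :: "real \<Rightarrow> nat \<Rightarrow> complex"
  where "arch_char u n = cis (u * ln (real n))"

definition coprime_pairs :: "nat \<Rightarrow> (nat \<times> nat) set"
  where "coprime_pairs N = {(b, c). b \<in> {1..N} \<and> c \<in> {1..N} \<and> coprime b c}"

lemma finite_coprime_pairs [simp]: "finite (coprime_pairs N)"
  by (rule finite_subset[of _ "{1..N} \<times> {1..N}"]) (auto simp: coprime_pairs_def)

lemma bij_betw_coprime_pairs:
  "bij_betw (\<lambda>((b, c), a). (a * b, a * c))
     (SIGMA (b, c):coprime_pairs N. {1..N div max b c}) ({1..N} \<times> {1..N})"
  unfolding bij_betw_def
proof (intro conjI)
  show "inj_on (\<lambda>((b, c), a). (a * b, a * c)) (SIGMA (b, c):coprime_pairs N. {1..N div max b c})"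
  proof (rule inj_onI, clarsimp simp: coprime_pairs_def)
    fix a b c a' b' c' :: nat
    assume *: "a * b = a' * b'" "a * c = a' * c'" and cop: "coprime b c" "coprime b' c'"
      and pos: "Suc 0 \<le> a" "Suc 0 \<le> a'"
    have "a = gcd (a * b) (a * c)" using cop(1) by (simp add: gcd_mult_distrib_nat[symmetric])
    also have "\<dots> = a'" unfolding * using cop(2) by (simp add: gcd_mult_distrib_nat[symmetric])
    finally show "b = b' \<and> c = c' \<and> a = a'" using * pos by auto
  qed
  show "(\<lambda>((b, c), a). (a * b, a * c)) ` (SIGMA (b, c):coprime_pairs N. {1..N div max b c}) = {1..N} \<times> {1..N}"
  proof (intro equalityI subsetI)
    fix z assume "z \<in> (\<lambda>((b, c), a). (a * b, a * c)) ` (SIGMA (b, c):coprime_pairs N. {1..N div max b c})"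
    then obtain a b c where z: "z = (a * b, a * c)" and bc: "(b, c) \<in> coprime_pairs N"
      and a: "1 \<le> a" "a \<le> N div max b c" by auto
    have m: "max b c > 0" using bc by (auto simp: coprime_pairs_def)
    then have "a * max b c \<le> N" using a by (simp add: less_eq_div_iff_mult_less_eq)
    then have "a * b \<le> N" "a * c \<le> N"
      by (meson max.cobounded1 max.cobounded2 mult_le_mono2 order_trans)+
    then show "z \<in> {1..N} \<times> {1..N}" using z a bc by (auto simp: coprime_pairs_def)
  next
    fix z assume "z \<in> {1..N} \<times> {1..N}"
    then obtain m n where z: "z = (m, n)" "m \<in> {1..N}" "n \<in> {1..N}" by auto
    define a where "a = gcd m n"
    define b c where "b = m div a" and "c = n div a"
    have a: "a > 0" using z by (simp add: a_def)
    have mn: "m = a * b" "n = a * c" by (simp_all add: a_def b_def c_def)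
    have bc: "b > 0" "c > 0" using mn z by (auto intro!: Nat.gr0I)
    have "coprime b c" unfolding a_def b_def c_def using z by (intro div_gcd_coprime) auto
    moreover have "b \<le> N" "c \<le> N" using z by (auto simp: b_def c_def intro: order_trans[OF div_le_dividend])
    ultimately have cp: "(b, c) \<in> coprime_pairs N" using bc by (auto simp: coprime_pairs_def)
    have "a * max b c \<le> N" using z mn by (simp add: max_def)
    then have "a \<le> N div max b c" using bc by (simp add: less_eq_div_iff_mult_less_eq)
    then show "z \<in> (\<lambda>((b, c), a). (a * b, a * c)) ` (SIGMA (b, c):coprime_pairs N. {1..N div max b c})"
      using a cp z mn by (intro image_eqI[of _ _ "((b, c), a)"]) auto
  qed
qed

text \<open>
  Collect the pairs \<open>(m, n)\<close> of indices in the squared modulus by the reduced fraction \<open>b / c\<close> that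
  \<open>m / n\<close> represents. The coefficient of the frequency \<open>ln b - ln c\<close> is then a geometric sum, and
  distinct reduced fractions have distinct frequencies.
\<close>

lemma norm_square_arch_twisted_sum:
  "of_real ((norm (twisted_sum (arch_char u) N \<theta>))\<^sup>2) =
     (\<Sum>(b, c)\<in>coprime_pairs N.
        dirichlet_sum (N div max b c) ((real b - real c) * \<theta>) * cis (u * (ln (real b) - ln (real c))))"
proof -
  define G :: "nat \<times> nat \<Rightarrow> complex"
    where "G = (\<lambda>(m, n). e ((real m - real n) * \<theta>) * cis (u * (ln (real m) - ln (real n))))"
  have "of_real ((norm (twisted_sum (arch_char u) N \<theta>))\<^sup>2) =
      twisted_sum (arch_char u) N \<theta> * cnj (twisted_sum (arch_char u) N \<theta>)"
    by (simp add: complex_norm_square del: of_real_power)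
  also have "\<dots> = (\<Sum>m=1..N. \<Sum>n=1..N. G (m, n))"
  proof -
    have "arch_char u m * e (real m * \<theta>) * cnj (arch_char u n * e (real n * \<theta>)) = G (m, n)" for m n
    proof -
      have "e ((real m - real n) * \<theta>) = e (real m * \<theta>) * cnj (e (real n * \<theta>))"
        by (simp add: left_diff_distrib e_minus[symmetric] e_add[symmetric])
      moreover have "cis (u * (ln (real m) - ln (real n))) = arch_char u m * cnj (arch_char u n)"
        by (simp add: arch_char_def cis_cnj cis_mult right_diff_distrib)
      ultimately show ?thesis by (simp add: G_def)
    qed
    then show ?thesis by (simp add: twisted_sum_def sum_product)
  qed
  also have "\<dots> = sum G ({1..N} \<times> {1..N})" by (simp add: sum.cartesian_product)
  also have "\<dots> = (\<Sum>z\<in>(SIGMA (b, c):coprime_pairs N. {1..N div max b c}). G ((\<lambda>((b, c), a). (a * b, a * c)) z))"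
    by (rule sum.reindex_bij_betw[OF bij_betw_coprime_pairs, symmetric])
  also have "\<dots> = (\<Sum>p\<in>coprime_pairs N. \<Sum>a\<in>(case p of (b, c) \<Rightarrow> {1..N div max b c}).
      G ((\<lambda>((b, c), a). (a * b, a * c)) (p, a)))"
    by (subst sum.Sigma) (auto simp: case_prod_unfold)
  also have "\<dots> = (\<Sum>(b, c)\<in>coprime_pairs N. \<Sum>a=1..N div max b c. G (a * b, a * c))"
    by (intro sum.cong) auto
  also have "\<dots> = (\<Sum>(b, c)\<in>coprime_pairs N.
        dirichlet_sum (N div max b c) ((real b - real c) * \<theta>) * cis (u * (ln (real b) - ln (real c))))"
  proof (intro sum.cong refl, clarify)
    fix b c assume bc: "(b, c) \<in> coprime_pairs N"
    have "G (a * b, a * c) = e (real a * ((real b - real c) * \<theta>)) * cis (u * (ln (real b) - ln (real c)))"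
      if "a \<in> {1..N div max b c}" for a
      using that bc by (simp add: G_def coprime_pairs_def ln_mult algebra_simps)
    then show "(\<Sum>a=1..N div max b c. G (a * b, a * c)) =
        dirichlet_sum (N div max b c) ((real b - real c) * \<theta>) * cis (u * (ln (real b) - ln (real c)))"
      by (simp add: dirichlet_sum_def sum_distrib_right)
  qed
  finally show ?thesis .
qed

text \<open>
  Averages over integers \<open>t\<close> see frequencies only modulo \<open>2 pi\<close>. The twist parameter
  therefore runs over the multiples of a \<open>\<delta>\<close> so small that no two frequencies are congruent.
\<close>

lemma log_ratio_abs_le:
  assumes "p \<in> coprime_pairs N" "\<delta> > 0" "\<delta> * ln (real N) \<le> 1"
  shows "\<bar>\<delta> * (ln (real (fst p)) - ln (real (snd p)))\<bar> \<le> 1"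
proof -
  obtain b c where p: "p = (b, c)" "1 \<le> b" "b \<le> N" "1 \<le> c" "c \<le> N"
    using assms(1) by (auto simp: coprime_pairs_def)
  have "0 \<le> ln (real b)" "0 \<le> ln (real c)" "ln (real b) \<le> ln (real N)" "ln (real c) \<le> ln (real N)"
    using p by auto
  then have "\<bar>ln (real b) - ln (real c)\<bar> \<le> ln (real N)" by linarith
  then have "\<delta> * \<bar>ln (real b) - ln (real c)\<bar> \<le> \<delta> * ln (real N)" using assms(2) by (intro mult_left_mono) auto
  then have "\<delta> * \<bar>ln (real b) - ln (real c)\<bar> \<le> 1" using assms(3) by linarith
  then show ?thesis using assms(2) p(1) by (simp add: abs_mult)
qed

lemma log_ratio_eq_iff:
  assumes "p \<in> coprime_pairs N" "p' \<in> coprime_pairs N"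
  shows "ln (real (fst p)) - ln (real (snd p)) = ln (real (fst p')) - ln (real (snd p')) \<longleftrightarrow> p = p'"
proof
  assume eq: "ln (real (fst p)) - ln (real (snd p)) = ln (real (fst p')) - ln (real (snd p'))"
  obtain b c where p: "p = (b, c)" "b > 0" "c > 0" "coprime b c"
    using assms(1) by (auto simp: coprime_pairs_def)
  obtain b' c' where p': "p' = (b', c')" "b' > 0" "c' > 0" "coprime b' c'"
    using assms(2) by (auto simp: coprime_pairs_def)
  have "ln (real (b * c')) = ln (real (b' * c))"
    using eq p p' by (simp add: ln_mult)
  then have "real (b * c') = real (b' * c)"
    using p p' by (subst (asm) ln_inj_iff) auto
  then have "b * c' = b' * c" by (simp only: of_nat_eq_iff)
  then show "p = p'" using p p' coprime_crossproduct_nat[of b c b' c'] by (simp add: mult_ac)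
qed auto

text \<open>
  Only the frequency zero, that is the fraction \<open>1 / 1\<close>, survives in the mean.
\<close>

lemma mean_square_arch:
  assumes N: "N \<ge> 1" and \<delta>: "\<delta> > 0" "\<delta> * ln (real N) \<le> 1"
  shows "(\<lambda>T. (\<Sum>t<T. (norm (twisted_sum (arch_char (real t * \<delta>)) N \<theta>))\<^sup>2) / real T) \<longlonglongrightarrow> real N"
proof -
  define \<mu> where "\<mu> = (\<lambda>(b, c). \<delta> * (ln (real b) - ln (real c)))"
  define d where "d = (\<lambda>(b, c). dirichlet_sum (N div max b c) ((real b - real c) * \<theta>))"
  have small: "\<bar>\<mu> p\<bar> < 2 * pi" if "p \<in> coprime_pairs N" for p
    using log_ratio_abs_le[OF that \<delta>] pi_gt3 by (auto simp: \<mu>_def case_prod_unfold)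
  have "(1, 1) \<in> coprime_pairs N" using N by (simp add: coprime_pairs_def)
  then have zero: "\<mu> p = 0 \<longleftrightarrow> p = (1, 1)" if "p \<in> coprime_pairs N" for p
    using log_ratio_eq_iff[OF that, of "(1, 1)"] \<delta>(1) by (auto simp: \<mu>_def case_prod_unfold)
  have "(\<lambda>T. (\<Sum>t<T. \<Sum>p\<in>coprime_pairs N. d p * cis (real t * \<mu> p)) / of_nat T)
      \<longlonglongrightarrow> (\<Sum>p\<in>coprime_pairs N. if \<mu> p = 0 then d p else 0)"
    by (rule mean_trig_sum) (use small in auto)
  also have "(\<lambda>T. (\<Sum>t<T. \<Sum>p\<in>coprime_pairs N. d p * cis (real t * \<mu> p)) / of_nat T) =
     (\<lambda>T. of_real ((\<Sum>t<T. (norm (twisted_sum (arch_char (real t * \<delta>)) N \<theta>))\<^sup>2) / real T))"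
    unfolding of_real_divide of_real_sum norm_square_arch_twisted_sum
    by (simp add: d_def \<mu>_def case_prod_unfold mult_ac)
  also have "(\<Sum>p\<in>coprime_pairs N. if \<mu> p = 0 then d p else 0) = (\<Sum>p\<in>coprime_pairs N. if p = (1, 1) then d p else 0)"
    by (intro sum.cong) (auto simp: zero)
  also have "\<dots> = of_real (real N)"
  proof -
    have "(1, 1) \<in> coprime_pairs N" using N by (simp add: coprime_pairs_def)
    then have "(\<Sum>p\<in>coprime_pairs N. if p = (1, 1) then d p else 0) = d (1, 1)" by (simp add: sum.delta)
    also have "\<dots> = of_real (real N)" by (simp add: d_def dirichlet_sum_def)
    finally show ?thesis .
  qed
  finally show ?thesis by (simp only: tendsto_of_real_iff)
qed

text \<open>
  Parseval's identity for the expansion of the squared modulus.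
\<close>

lemma mean_fourth_power_arch:
  assumes N: "N \<ge> 1" and \<delta>: "\<delta> > 0" "\<delta> * ln (real N) \<le> 1"
  shows "(\<lambda>T. (\<Sum>t<T. (norm (twisted_sum (arch_char (real t * \<delta>)) N \<theta>)) ^ 4) / real T)
    \<longlonglongrightarrow> (\<Sum>(b, c)\<in>coprime_pairs N. (norm (dirichlet_sum (N div max b c) ((real b - real c) * \<theta>)))\<^sup>2)"
proof -
  define \<mu> where "\<mu> = (\<lambda>(b, c). \<delta> * (ln (real b) - ln (real c)))"
  define d where "d = (\<lambda>(b, c). dirichlet_sum (N div max b c) ((real b - real c) * \<theta>))"
  define I where "I = coprime_pairs N \<times> coprime_pairs N"
  have S: "of_real ((norm (twisted_sum (arch_char (real t * \<delta>)) N \<theta>))\<^sup>2) =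
      (\<Sum>p\<in>coprime_pairs N. d p * cis (real t * \<mu> p))" for t
    unfolding norm_square_arch_twisted_sum by (simp add: d_def \<mu>_def case_prod_unfold mult_ac)
  have S4: "of_real ((norm (twisted_sum (arch_char (real t * \<delta>)) N \<theta>)) ^ 4) =
      (\<Sum>(p, p')\<in>I. (d p * cnj (d p')) * cis (real t * (\<mu> p - \<mu> p')))" for t
  proof -
    define R where "R = (norm (twisted_sum (arch_char (real t * \<delta>)) N \<theta>))\<^sup>2"
    have "(norm (twisted_sum (arch_char (real t * \<delta>)) N \<theta>)) ^ 4 = R * R"
      by (simp add: R_def flip: power_add)
    then have "complex_of_real ((norm (twisted_sum (arch_char (real t * \<delta>)) N \<theta>)) ^ 4) = of_real R * cnj (of_real R)"
      by simp
    also have "\<dots> = (\<Sum>p\<in>coprime_pairs N. \<Sum>p'\<in>coprime_pairs N.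
        (d p * cis (real t * \<mu> p)) * cnj (d p' * cis (real t * \<mu> p')))"
      unfolding R_def S by (simp add: sum_product)
    also have "\<dots> = (\<Sum>(p, p')\<in>I. (d p * cnj (d p')) * cis (real t * (\<mu> p - \<mu> p')))"
      unfolding I_def sum.cartesian_product
      by (intro sum.cong refl) (auto simp: cis_cnj right_diff_distrib cis_mult mult_ac)
    finally show ?thesis .
  qed
  have small: "\<bar>\<mu> p\<bar> \<le> 1" if "p \<in> coprime_pairs N" for p
    using log_ratio_abs_le[OF that \<delta>] by (simp add: \<mu>_def case_prod_unfold)
  have zero: "\<mu> p = \<mu> p' \<longleftrightarrow> p = p'" if "p \<in> coprime_pairs N" "p' \<in> coprime_pairs N" for p p'
    using log_ratio_eq_iff[OF that] \<delta>(1) by (simp add: \<mu>_def case_prod_unfold)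
  have "(\<lambda>T. (\<Sum>t<T. \<Sum>i\<in>I. (\<lambda>(p, p'). d p * cnj (d p')) i * cis (real t * (\<lambda>(p, p'). \<mu> p - \<mu> p') i)) / of_nat T)
      \<longlonglongrightarrow> (\<Sum>i\<in>I. if (\<lambda>(p, p'). \<mu> p - \<mu> p') i = 0 then (\<lambda>(p, p'). d p * cnj (d p')) i else 0)"
  proof (rule mean_trig_sum)
    fix i assume "i \<in> I"
    then obtain p p' where i: "i = (p, p')" "p \<in> coprime_pairs N" "p' \<in> coprime_pairs N" by (auto simp: I_def)
    show "\<bar>(\<lambda>(p, p'). \<mu> p - \<mu> p') i\<bar> < 2 * pi" using small[OF i(2)] small[OF i(3)] pi_gt3 i by auto
  qed (simp add: I_def)
  also have "(\<lambda>T. (\<Sum>t<T. \<Sum>i\<in>I. (\<lambda>(p, p'). d p * cnj (d p')) i * cis (real t * (\<lambda>(p, p'). \<mu> p - \<mu> p') i)) / of_nat T) =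
     (\<lambda>T. of_real ((\<Sum>t<T. (norm (twisted_sum (arch_char (real t * \<delta>)) N \<theta>)) ^ 4) / real T))"
    unfolding of_real_divide of_real_sum S4 by (simp add: case_prod_unfold)
  also have "(\<Sum>i\<in>I. if (\<lambda>(p, p'). \<mu> p - \<mu> p') i = 0 then (\<lambda>(p, p'). d p * cnj (d p')) i else 0) =
     (\<Sum>p\<in>coprime_pairs N. \<Sum>p'\<in>coprime_pairs N. if p' = p then d p * cnj (d p') else 0)"
    unfolding I_def sum.cartesian_product by (intro sum.cong) (auto simp: zero)
  also have "\<dots> = (\<Sum>p\<in>coprime_pairs N. of_real ((norm (d p))\<^sup>2))"
    by (intro sum.cong) (simp_all add: sum.delta complex_norm_square del: of_real_power)
  also have "\<dots> = of_real (\<Sum>(b, c)\<in>coprime_pairs N. (norm (dirichlet_sum (N div max b c) ((real b - real c) * \<theta>)))\<^sup>2)"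
    by (simp add: d_def case_prod_unfold)
  finally show ?thesis by (simp only: tendsto_of_real_iff)
qed

lemma norm_dirichlet_sum_minus: "norm (dirichlet_sum L (- t)) = norm (dirichlet_sum L t)"
proof -
  have "dirichlet_sum L (- t) = cnj (dirichlet_sum L t)"
    by (simp add: dirichlet_sum_def e_minus)
  then show ?thesis by simp
qed

text \<open>
  The pair \<open>(1, 1)\<close> gives \<open>N\<^sup>2\<close>. For the other pairs, symmetry permits \<open>c < b\<close>; then substitute
  \<open>k = b - c\<close> and drop the coprimality condition.
\<close>

lemma sum_coprime_pairs_le:
  fixes N :: nat and \<theta> :: real
  defines "W \<equiv> (\<lambda>(b, c). (norm (dirichlet_sum (N div max b c) ((real b - real c) * \<theta>)))\<^sup>2)"
  shows "(\<Sum>p\<in>coprime_pairs N. W p) \<le>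
    (real N)\<^sup>2 + 2 * (\<Sum>b=1..N. \<Sum>k=1..<b. (norm (dirichlet_sum (N div b) (real k * \<theta>)))\<^sup>2)"
proof -
  define U where "U = (SIGMA b:{1..N}. {1..<b})"
  have W0: "W p \<ge> 0" for p by (simp add: W_def case_prod_unfold)
  have un: "sum W (A \<union> B) \<le> sum W A + sum W B" if "finite A" "finite B" for A B
    using sum.union_inter[OF that, of W] sum_nonneg[of "A \<inter> B" W] W0 by simp
  have swap: "W (c, b) = W (b, c)" for b c
    using norm_dirichlet_sum_minus[of "N div max b c" "(real b - real c) * \<theta>"]
    by (simp add: W_def max.commute algebra_simps)
  have sU: "sum W U = (\<Sum>b=1..N. \<Sum>k=1..<b. (norm (dirichlet_sum (N div b) (real k * \<theta>)))\<^sup>2)"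
  proof -
    have "sum W U = (\<Sum>b=1..N. \<Sum>c=1..<b. W (b, c))"
      unfolding U_def by (subst sum.Sigma) auto
    also have "\<dots> = (\<Sum>b=1..N. \<Sum>k=1..<b. (norm (dirichlet_sum (N div b) (real k * \<theta>)))\<^sup>2)"
    proof (rule sum.cong[OF refl])
      fix b
      show "(\<Sum>c=1..<b. W (b, c)) = (\<Sum>k=1..<b. (norm (dirichlet_sum (N div b) (real k * \<theta>)))\<^sup>2)"
        by (rule sum.reindex_bij_witness[of _ "\<lambda>k. b - k" "\<lambda>c. b - c"])
           (auto simp: W_def of_nat_diff max_def)
    qed
    finally show ?thesis .
  qed
  have "coprime_pairs N \<subseteq> {(1, 1)} \<union> (U \<union> prod.swap ` U)"
  proof
    fix p assume "p \<in> coprime_pairs N"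
    then obtain b c where p: "p = (b, c)" "b \<in> {1..N}" "c \<in> {1..N}" "coprime b c"
      by (auto simp: coprime_pairs_def)
    consider "b = c" | "c < b" | "b < c" by linarith
    then show "p \<in> {(1, 1)} \<union> (U \<union> prod.swap ` U)"
    proof cases
      case 1 then show ?thesis using p by simp
    next
      case 2 then show ?thesis using p by (auto simp: U_def)
    next
      case 3
      then have "(c, b) \<in> U" using p by (auto simp: U_def)
      then have "prod.swap (c, b) \<in> prod.swap ` U" by (rule imageI)
      then show ?thesis using p by simp
    qed
  qed
  moreover have fin: "finite U" by (simp add: U_def)
  ultimately have "sum W (coprime_pairs N) \<le> sum W ({(1, 1)} \<union> (U \<union> prod.swap ` U))"
    using W0 by (intro sum_mono2) auto
  also have "\<dots> \<le> sum W {(1, 1)} + sum W (U \<union> prod.swap ` U)"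
    using fin by (intro un) auto
  also have "sum W (U \<union> prod.swap ` U) \<le> sum W U + sum W (prod.swap ` U)"
    using fin by (intro un) auto
  also have "sum W (prod.swap ` U) = sum W U"
    by (subst sum.reindex) (auto simp: swap intro!: sum.cong)
  also have "sum W {(1, 1)} = (real N)\<^sup>2" by (simp add: W_def dirichlet_sum_def)
  finally show ?thesis by (simp add: sU)
qed

text \<open>
  A second moment of order \<open>M\<close> and a fourth moment of order \<open>M\<^sup>2\<close> force a first moment of order
  \<open>sqrt M\<close>. Instead of Hoelder's inequality the proof averages the pointwise inequality
  \<open>v \<ge> v\<^sup>2 - v ^ 4 / 4\<close> with \<open>v = s / l\<close>, which is linear in the moments and so can be summed over \<open>A\<close>
  before one twist is selected.
\<close>

lemma exists_arch_char_large:
  fixes A :: "'a set" and N :: "'a \<Rightarrow> nat" and \<theta> :: "'a \<Rightarrow> real" and M :: real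
  assumes A: "finite A" and M: "M \<ge> 1"
    and N: "\<And>p. p \<in> A \<Longrightarrow> 1 \<le> N p \<and> M / 9 \<le> real (N p) \<and> real (N p) \<le> M"
    and fourth: "\<And>p. p \<in> A \<Longrightarrow> (\<Sum>(b, c)\<in>coprime_pairs (N p).
      (norm (dirichlet_sum (N p div max b c) ((real b - real c) * \<theta> p)))\<^sup>2) \<le> 673 * M\<^sup>2"
  shows "\<exists>u. real (card A) * sqrt M / 1000 \<le> (\<Sum>p\<in>A. norm (twisted_sum (arch_char u) (N p) (\<theta> p)))"
proof (cases "A = {}")
  case False
  then have cA: "card A > 0" using A by (simp add: card_gt_0_iff)
  define \<delta> where "\<delta> = 1 / (1 + ln M)"
  have \<delta>: "\<delta> > 0" using M by (simp add: \<delta>_def add_pos_nonneg)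
  have \<delta>N: "\<delta> * ln (real (N p)) \<le> 1" if "p \<in> A" for p
  proof -
    have "ln (real (N p)) \<le> ln M" using N[OF that] by simp
    then show ?thesis using M \<delta> by (simp add: \<delta>_def field_simps add_pos_nonneg)
  qed
  define S where "S t p = norm (twisted_sum (arch_char (real t * \<delta>)) (N p) (\<theta> p))" for t :: nat and p
  define E where "E p = (\<Sum>(b, c)\<in>coprime_pairs (N p).
      (norm (dirichlet_sum (N p div max b c) ((real b - real c) * \<theta> p)))\<^sup>2)" for p
  \<comment> \<open>The factor 60 makes the second-moment gain \<open>1 / 540\<close> exceed
    the fourth-moment loss \<open>673 / 864000\<close> by more than \<open>1 / 1000\<close>.\<close>
  define l where "l = 60 * sqrt M"
  have l: "l > 0" using M by (simp add: l_def)
  have low: "s \<ge> s\<^sup>2 / l - s ^ 4 / (4 * l ^ 3)" if "s \<ge> 0" for s :: real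
  proof -
    define v where "v = s / l"
    have v: "v \<ge> 0" "s = l * v" using that l by (simp_all add: v_def)
    have "v\<^sup>2 - v ^ 4 / 4 \<le> v"
    proof (cases "v \<le> 1")
      case True
      then have "v\<^sup>2 \<le> v" using v by (simp add: power2_eq_square mult_left_le)
      moreover have "0 \<le> v ^ 4" by simp
      ultimately show ?thesis by linarith
    next
      case False
      have "0 \<le> (v\<^sup>2 - 2)\<^sup>2" by simp
      also have "(v\<^sup>2 - 2)\<^sup>2 = v ^ 4 - 4 * v\<^sup>2 + 4" by (simp add: power2_eq_square algebra_simps eval_nat_numeral)
      finally show ?thesis using False by linarith
    qed
    then have "l * (v\<^sup>2 - v ^ 4 / 4) \<le> l * v" using l by (intro mult_left_mono) auto
    also have "l * (v\<^sup>2 - v ^ 4 / 4) = s\<^sup>2 / l - s ^ 4 / (4 * l ^ 3)"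
      using l by (simp add: v(2) field_simps eval_nat_numeral)
    finally show ?thesis by (simp add: v(2))
  qed
  show ?thesis
  proof (rule ccontr)
    assume "\<not> ?thesis"
    then have up: "(\<Sum>p\<in>A. S t p) < real (card A) * sqrt M / 1000" for t
      by (auto simp: S_def not_le)
    have "(\<lambda>T. \<Sum>p\<in>A. (\<Sum>t<T. (S t p)\<^sup>2) / real T / l - (\<Sum>t<T. (S t p) ^ 4) / real T / (4 * l ^ 3))
        \<longlonglongrightarrow> (\<Sum>p\<in>A. real (N p) / l - E p / (4 * l ^ 3))"
      unfolding S_def E_def using l N \<delta> \<delta>N
      by (intro tendsto_intros mean_square_arch mean_fourth_power_arch) auto
    moreover have "(\<Sum>p\<in>A. (\<Sum>t<T. (S t p)\<^sup>2) / real T / l - (\<Sum>t<T. (S t p) ^ 4) / real T / (4 * l ^ 3))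
        \<le> real (card A) * sqrt M / 1000" if "T > 0" for T
    proof -
      have "(\<Sum>p\<in>A. (\<Sum>t<T. (S t p)\<^sup>2) / real T / l - (\<Sum>t<T. (S t p) ^ 4) / real T / (4 * l ^ 3))
          = (\<Sum>p\<in>A. \<Sum>t<T. ((S t p)\<^sup>2 / l - (S t p) ^ 4 / (4 * l ^ 3)) / real T)"
        by (intro sum.cong refl) (simp add: sum_subtractf sum_divide_distrib diff_divide_distrib mult_ac)
      also have "\<dots> \<le> (\<Sum>p\<in>A. \<Sum>t<T. S t p / real T)"
        by (intro sum_mono divide_right_mono low) (auto simp: S_def)
      also have "\<dots> = (\<Sum>t<T. \<Sum>p\<in>A. S t p / real T)" by (rule sum.swap)
      also have "\<dots> = (\<Sum>t<T. (\<Sum>p\<in>A. S t p) / real T)" by (simp add: sum_divide_distrib)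
      also have "\<dots> \<le> (\<Sum>t<T. (real (card A) * sqrt M / 1000) / real T)"
        using up by (intro sum_mono divide_right_mono less_imp_le) auto
      also have "\<dots> = real (card A) * sqrt M / 1000" using that by simp
      finally show ?thesis .
    qed
    then have "\<forall>\<^sub>F T in sequentially.
      (\<Sum>p\<in>A. (\<Sum>t<T. (S t p)\<^sup>2) / real T / l - (\<Sum>t<T. (S t p) ^ 4) / real T / (4 * l ^ 3))
        \<le> real (card A) * sqrt M / 1000"
      using eventually_gt_at_top[of 0] by (rule eventually_mono[rotated])
    ultimately have "(\<Sum>p\<in>A. real (N p) / l - E p / (4 * l ^ 3)) \<le> real (card A) * sqrt M / 1000"
      by (rule tendsto_upperbound) simp
    moreover have "(\<Sum>p\<in>A. real (N p) / l - E p / (4 * l ^ 3)) \<ge> (\<Sum>p\<in>A. sqrt M / 960)"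
    proof (rule sum_mono)
      fix p assume p: "p \<in> A"
      define s where "s = sqrt M"
      have s: "s > 0" "M = s\<^sup>2" using M by (simp_all add: s_def)
      have "real (N p) / l \<ge> (M / 9) / l" using N[OF p] l by (intro divide_right_mono) auto
      moreover have "(M / 9) / l = s / 540" using s by (simp add: l_def s_def[symmetric] power2_eq_square)
      moreover have "E p / (4 * l ^ 3) \<le> 673 * M\<^sup>2 / (4 * l ^ 3)"
        unfolding E_def using fourth[OF p] l by (intro divide_right_mono) auto
      moreover have "673 * M\<^sup>2 / (4 * l ^ 3) = 673 / 864000 * s"
        using s by (simp add: l_def s_def[symmetric] field_simps eval_nat_numeral)
      ultimately show "sqrt M / 960 \<le> real (N p) / l - E p / (4 * l ^ 3)"
        using s(1) by (simp add: s_def[symmetric])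
    qed
    ultimately have "(\<Sum>p\<in>A. sqrt M / 960) \<le> real (card A) * sqrt M / 1000" by (rule order_trans[rotated])
    moreover have "sqrt M * real (card A) > 0" using cA M by simp
    ultimately show False by (simp add: mult.commute)
  qed
qed auto

section \<open>Aligning the contributions of large primes\<close>

lemma prod_dividing_coprime:
  fixes P :: "nat set" and c :: "nat \<Rightarrow> complex"
  assumes "finite P" "\<And>p. p \<in> P \<Longrightarrow> prime p" "coprime m n"
  shows "(\<Prod>p\<in>{p \<in> P. p dvd m * n}. c p) = (\<Prod>p\<in>{p \<in> P. p dvd m}. c p) * (\<Prod>p\<in>{p \<in> P. p dvd n}. c p)"
proof -
  have "{p \<in> P. p dvd m * n} = {p \<in> P. p dvd m} \<union> {p \<in> P. p dvd n}"
    using assms(2) by (auto simp: prime_dvd_mult_iff)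
  moreover have "{p \<in> P. p dvd m} \<inter> {p \<in> P. p dvd n} = {}"
  proof -
    have False if "x \<in> P" "x dvd m" "x dvd n" for x
      using coprime_common_divisor[OF assms(3) that(2,3)] assms(2)[OF that(1)] by simp
    then show ?thesis by blast
  qed
  ultimately show ?thesis using assms(1) by (simp add: prod.union_disjoint)
qed

lemma norm_prod_le_1:
  assumes "\<And>p. p \<in> A \<Longrightarrow> norm (c p :: complex) \<le> 1"
  shows "norm (\<Prod>p\<in>A. c p) \<le> 1"
  unfolding prod_norm[symmetric] using assms by (intro prod_le_1) auto

text \<open>
  Each \<open>p \<in> P\<close> exceeds \<open>x / p'\<close> for every \<open>p' \<in> P\<close>, so an integer up to \<open>x\<close> has at most one prime
  factor in \<open>P\<close>, to the first power. The values of \<open>f\<close> on \<open>P\<close> are therefore free: they are chosen to rotate the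
  contribution of each \<open>p\<close> into the direction of the part of the sum without prime factors in \<open>P\<close>,
  so that nothing cancels.
\<close>

lemma exists_aligned_multiplicative:
  fixes g :: "nat \<Rightarrow> complex" and P :: "nat set" and x y L \<alpha> :: real
  assumes g: "multiplicative g" "\<And>n. n > 0 \<Longrightarrow> norm (g n) \<le> 1"
    and P: "finite P" "\<And>p. p \<in> P \<Longrightarrow> prime p" "\<And>p. p \<in> P \<Longrightarrow> norm (g p) = 1"
    and L: "\<And>p. p \<in> P \<Longrightarrow> L \<le> real p \<and> real p \<le> y \<and> x / real p < L" and x: "x \<ge> 0"
  shows "\<exists>f. multiplicative f \<and> (\<forall>n>0. f n \<in> unit_disc) \<and>
    (\<Sum>p\<in>P. norm (twisted_sum g (nat \<lfloor>x / real p\<rfloor>) (real p * \<alpha>)))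
      \<le> norm (\<Sum>n | n > 0 \<and> real n \<le> x \<and> real (largest_prime_factor n) \<le> y. f n * e (real n * \<alpha>))"
proof -
  define N where "N p = nat \<lfloor>x / real p\<rfloor>" for p :: nat
  define S where "S p = twisted_sum g (N p) (real p * \<alpha>)" for p
  define Z where "Z = {n. n > 0 \<and> real n \<le> x \<and> real (largest_prime_factor n) \<le> y}"
  define Z0 where "Z0 = {n \<in> Z. \<forall>p\<in>P. \<not> p dvd n}"
  define Z1 where "Z1 = {n \<in> Z. \<exists>p\<in>P. p dvd n}"
  define A0 where "A0 = (\<Sum>n\<in>Z0. g n * e (real n * \<alpha>))"
  define u where "u = (if A0 = 0 then 1 else sgn A0)"
  define c where "c p = u * cnj (sgn (g p * S p))" for p
  define f where "f n = g n * (\<Prod>p\<in>{p \<in> P. p dvd n}. c p)" for n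
  have u: "norm u = 1" "A0 = of_real (norm A0) * u"
    by (auto simp: u_def sgn_eq norm_divide)
  have c1: "norm (c p) \<le> 1" for p
    using u by (simp add: c_def norm_mult norm_sgn)
  have mult_f: "multiplicative f"
    unfolding multiplicative_def
  proof (intro conjI allI impI)
    have "{p \<in> P. p dvd 1} = {}" using P(2) by (auto simp: prime_nat_iff)
    then show "f 1 = 1" using g(1) by (simp only: f_def multiplicative_def) simp
    fix m n :: nat assume "m > 0" "n > 0" "coprime m n"
    then show "f (m * n) = f m * f n"
      using g(1) prod_dividing_coprime[OF P(1,2), of m n c] by (simp add: f_def multiplicative_def)
  qed
  have f_disc: "\<forall>n>0. f n \<in> unit_disc"
  proof (intro allI impI)
    fix n :: nat assume "n > 0"
    then have "norm (f n) \<le> 1 * 1"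
      unfolding f_def norm_mult using g(2) norm_prod_le_1[of _ c] c1 by (intro mult_mono) auto
    then show "f n \<in> unit_disc" by (simp add: unit_disc_def)
  qed
  have small: "p' > m" if "p \<in> P" "p' \<in> P" "m \<in> {1..N p}" for p p' m
  proof -
    have "real m \<le> real (N p)" using that by simp
    also have "\<dots> \<le> x / real p" unfolding N_def using x by (intro of_nat_floor) auto
    also have "\<dots> < real p'" using L[OF that(1)] L[OF that(2)] by linarith
    finally show ?thesis by simp
  qed
  have nd: "\<not> p' dvd m" if "p \<in> P" "p' \<in> P" "m \<in> {1..N p}" for p p' m
    using small[OF that] that(3) by (auto dest: dvd_imp_le)
  have finZ: "finite Z"
    by (rule finite_subset[of _ "{..nat \<lfloor>x\<rfloor>}"]) (auto simp: Z_def le_nat_floor)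
  have bij: "bij_betw (\<lambda>(p, m). p * m) (SIGMA p:P. {1..N p}) Z1"
    unfolding bij_betw_def
  proof (intro conjI)
    show "inj_on (\<lambda>(p, m). p * m) (SIGMA p:P. {1..N p})"
    proof (rule inj_onI, clarsimp)
      fix p m p' m' assume *: "p \<in> P" "p' \<in> P" "p * m = p' * m'"
        "Suc 0 \<le> m" "m \<le> N p" "Suc 0 \<le> m'" "m' \<le> N p'"
      have "p dvd p' * m'" using *(3) by (metis dvd_triv_left)
      then have "p dvd p' \<or> p dvd m'" using P(2)[OF *(1)] by (simp add: prime_dvd_mult_iff)
      moreover have "\<not> p dvd m'" using nd[of p' p m'] * by simp
      ultimately have "p = p'" using P(2) *(1,2) by (simp add: primes_dvd_imp_eq)
      then show "p = p' \<and> m = m'" using * P(2)[of p] by (auto simp: prime_nat_iff)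
    qed
    show "(\<lambda>(p, m). p * m) ` (SIGMA p:P. {1..N p}) = Z1"
    proof (intro equalityI subsetI)
      fix n assume "n \<in> (\<lambda>(p, m). p * m) ` (SIGMA p:P. {1..N p})"
      then obtain p m where n: "n = p * m" "p \<in> P" "m \<in> {1..N p}" by auto
      have p: "prime p" using P(2) n by blast
      have "real m \<le> x / real p"
      proof -
        have "real m \<le> real (N p)" using n by simp
        also have "\<dots> \<le> x / real p" unfolding N_def using x by (intro of_nat_floor) auto
        finally show ?thesis .
      qed
      then have "real n \<le> x" using n p prime_gt_0_nat[OF p] by (simp add: field_simps)
      moreover have "n > 0" using n p by (auto simp: prime_gt_0_nat)
      moreover have "real (largest_prime_factor n) \<le> y"
      proof -
        have n2: "n > 1"
          using n p prime_ge_2_nat[OF p] by (metis One_nat_def atLeastAtMost_iff less_1_mult mult.right_neutral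
              nat_less_le prime_gt_1_nat)
        have ne: "prime_factors n \<noteq> {}" using n2 by (simp add: prime_factorization_empty_iff)
        have "\<forall>q\<in>prime_factors n. q \<le> p"
        proof
          fix q assume "q \<in> prime_factors n"
          then have q: "prime q" "q dvd p * m" using n by auto
          then consider "q dvd p" | "q dvd m" by (auto simp: prime_dvd_mult_iff)
          then show "q \<le> p"
          proof cases
            case 1 then show ?thesis using q p by (auto dest: primes_dvd_imp_eq)
          next
            case 2
            then have "q \<le> m" using n by (auto dest: dvd_imp_le)
            then show ?thesis using small[of p p m] n by simp
          qed
        qed
        then have "Max (prime_factors n) \<le> p" using ne by (subst Max_le_iff) auto
        then show ?thesis using n2 L[OF n(2)] by (simp add: largest_prime_factor_def)
      qed
      ultimately show "n \<in> Z1" using n by (auto simp: Z1_def Z_def intro: bexI[of _ p])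
    next
      fix n assume "n \<in> Z1"
      then obtain p m where n: "n = p * m" "p \<in> P" "n > 0" "real n \<le> x"
        by (auto simp: Z1_def Z_def elim!: dvdE)
      have "p > 0" "m > 0" using n by auto
      then have "real m \<le> x / real p" using n by (simp add: field_simps)
      then have "m \<le> N p" by (simp add: N_def le_nat_floor)
      then show "n \<in> (\<lambda>(p, m). p * m) ` (SIGMA p:P. {1..N p})"
        using n \<open>m > 0\<close> by (intro image_eqI[of _ _ "(p, m)"]) auto
    qed
  qed
  have "(\<Sum>n\<in>Z. f n * e (real n * \<alpha>)) = (\<Sum>n\<in>Z0. f n * e (real n * \<alpha>)) + (\<Sum>n\<in>Z1. f n * e (real n * \<alpha>))"
  proof -
    have "Z = Z0 \<union> Z1" "Z0 \<inter> Z1 = {}" by (auto simp: Z0_def Z1_def)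
    then show ?thesis using finZ by (simp add: sum.union_disjoint)
  qed
  also have "(\<Sum>n\<in>Z0. f n * e (real n * \<alpha>)) = A0"
    unfolding A0_def
  proof (rule sum.cong[OF refl])
    fix n assume "n \<in> Z0"
    then have "{p \<in> P. p dvd n} = {}" by (auto simp: Z0_def)
    then show "f n * e (real n * \<alpha>) = g n * e (real n * \<alpha>)" by (simp only: f_def prod.empty mult_1_right)
  qed
  also have "(\<Sum>n\<in>Z1. f n * e (real n * \<alpha>)) = (\<Sum>p\<in>P. \<Sum>m=1..N p. f (p * m) * e (real (p * m) * \<alpha>))"
    using P(1) by (subst sum.reindex_bij_betw[OF bij, symmetric]) (simp add: sum.Sigma case_prod_unfold)
  also have "\<dots> = (\<Sum>p\<in>P. of_real (norm (S p)) * u)"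
  proof (rule sum.cong[OF refl])
    fix p assume p: "p \<in> P"
    have "f (p * m) * e (real (p * m) * \<alpha>) = c p * g p * (g m * e (real m * (real p * \<alpha>)))"
      if m: "m \<in> {1..N p}" for m
    proof -
      have "p > 0" "prime p" using P(2)[OF p] by (auto simp: prime_gt_0_nat)
      have "coprime p m" using nd[OF p p m] \<open>prime p\<close> by (simp add: prime_imp_coprime)
      then have gm: "g (p * m) = g p * g m" using g(1) m \<open>p > 0\<close> by (simp add: multiplicative_def)
      have "{p' \<in> P. p' dvd p * m} = {p}"
      proof (intro equalityI subsetI)
        fix p' assume p': "p' \<in> {p' \<in> P. p' dvd p * m}"
        then have "p' dvd p \<or> p' dvd m" using P(2) by (auto simp: prime_dvd_mult_iff)
        then have "p' dvd p" using nd[OF p _ m, of p'] p' by auto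
        then show "p' \<in> {p}" using primes_dvd_imp_eq[of p' p] P(2)[OF p] P(2)[of p'] p' by simp
      qed (use p in auto)
      then have "f (p * m) = g (p * m) * c p" by (simp only: f_def) simp
      then have "f (p * m) = g p * g m * c p" by (simp only: gm)
      then show ?thesis by (simp add: mult_ac)
    qed
    then have "(\<Sum>m=1..N p. f (p * m) * e (real (p * m) * \<alpha>)) = c p * (g p * S p)"
      by (simp add: S_def twisted_sum_def sum_distrib_left mult.assoc)
    also have "\<dots> = u * (cnj (sgn (g p * S p)) * (g p * S p))" by (simp add: c_def)
    also have "cnj (sgn (g p * S p)) * (g p * S p) = of_real (norm (g p * S p))"
    proof (cases "g p * S p = 0")
      case False
      have "cnj z / of_real (norm z) * z = of_real (norm z)" if "z \<noteq> 0" for z :: complex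
      proof -
        have "cnj z / of_real (norm z) * z = (z * cnj z) / of_real (norm z)" by simp
        also have "\<dots> = of_real ((norm z)\<^sup>2) / of_real (norm z)" by (simp only: complex_norm_square)
        also have "\<dots> = of_real (norm z)" using that by (simp add: power2_eq_square)
        finally show ?thesis .
      qed
      from this[OF False] show ?thesis by (simp add: sgn_eq)
    qed auto
    also have "norm (g p * S p) = norm (S p)" using P(3)[OF p] by (simp add: norm_mult)
    finally show "(\<Sum>m=1..N p. f (p * m) * e (real (p * m) * \<alpha>)) = of_real (norm (S p)) * u"
      by (simp add: mult.commute)
  qed
  also have "A0 + (\<Sum>p\<in>P. of_real (norm (S p)) * u) = of_real (norm A0 + (\<Sum>p\<in>P. norm (S p))) * u"
    using u(2) by (simp add: sum_distrib_right distrib_right)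
  finally have "norm (\<Sum>n\<in>Z. f n * e (real n * \<alpha>)) = norm A0 + (\<Sum>p\<in>P. norm (S p))"
    using u(1) by (simp add: norm_mult sum_nonneg add_nonneg_nonneg del: of_real_add of_real_sum)
  then have "(\<Sum>p\<in>P. norm (S p)) \<le> norm (\<Sum>n\<in>Z. f n * e (real n * \<alpha>))" by simp
  then show ?thesis using mult_f f_disc unfolding S_def N_def Z_def by blast
qed

text \<open>
  The function vanishes unless all prime factors lie in \<open>P \<union> Q\<close>. Up to \<open>N\<close> this leaves only 1 and
  the elements of \<open>Q\<close>, so a twisted sum reduces to a sum over primes with coefficients at our
  disposal.
\<close>

lemma exists_sparse_multiplicative:
  fixes P Q :: "nat set" and w :: "nat \<Rightarrow> complex"
  assumes P: "finite P" "\<And>p. p \<in> P \<Longrightarrow> prime p" and Q: "finite Q" "\<And>l. l \<in> Q \<Longrightarrow> prime l"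
    and disj: "P \<inter> Q = {}" and w: "\<And>l. l \<in> Q \<Longrightarrow> norm (w l) \<le> 1"
  shows "\<exists>g. multiplicative g \<and> (\<forall>n>0. norm (g n) \<le> 1) \<and> (\<forall>p\<in>P. norm (g p) = 1) \<and>
    (\<forall>N \<theta>. Q \<subseteq> {..N} \<longrightarrow> (\<forall>p\<in>P. N < p) \<longrightarrow> (\<forall>l\<in>Q. \<forall>l'\<in>Q. N < l * l') \<longrightarrow> N \<ge> 1 \<longrightarrow>
      twisted_sum g N \<theta> = e \<theta> + (\<Sum>l\<in>Q. w l * e (real l * \<theta>)))"
proof -
  define g where "g n = (if prime_factors n \<subseteq> P \<union> Q then \<Prod>l\<in>{l \<in> Q. l dvd n}. w l else 0)" for n
  have mult: "multiplicative g"
    unfolding multiplicative_def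
  proof (intro conjI allI impI)
    have "{l \<in> Q. l dvd 1} = {}" using Q(2) by (auto simp: prime_nat_iff)
    then show "g 1 = 1" by (simp only: g_def) simp
    fix m n :: nat assume mn: "m > 0" "n > 0" "coprime m n"
    then show "g (m * n) = g m * g n"
      using prod_dividing_coprime[OF Q mn(3), of w]
      by (auto simp: g_def prime_factors_product)
  qed
  have le1: "\<forall>n>0. norm (g n) \<le> 1"
    using w by (auto simp: g_def intro!: norm_prod_le_1)
  have gP: "\<forall>p\<in>P. norm (g p) = 1"
  proof
    fix p assume p: "p \<in> P"
    have "{l \<in> Q. l dvd p} = {}" using P(2)[OF p] Q(2) p disj by (auto dest: primes_dvd_imp_eq)
    moreover have "prime_factors p = {p}" using P(2)[OF p] by (simp add: prime_prime_factors)
    ultimately show "norm (g p) = 1" using p by (simp only: g_def) simp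
  qed
  have gQ: "g l = w l" if "l \<in> Q" for l
  proof -
    have "l' = l" if "l' \<in> Q" "l' dvd l" for l'
      using primes_dvd_imp_eq[of l' l] Q(2)[OF that(1)] Q(2)[OF \<open>l \<in> Q\<close>] that(2) by simp
    then have "{l' \<in> Q. l' dvd l} = {l}" using that by auto
    moreover have "prime_factors l = {l}" using Q(2)[OF that] by (simp add: prime_prime_factors)
    ultimately show ?thesis using that by (simp only: g_def) simp
  qed
  have "twisted_sum g N \<theta> = e \<theta> + (\<Sum>l\<in>Q. w l * e (real l * \<theta>))"
    if N: "Q \<subseteq> {..N}" "\<forall>p\<in>P. N < p" "\<forall>l\<in>Q. \<forall>l'\<in>Q. N < l * l'" "N \<ge> 1" for N \<theta>
  proof -
    have zero: "g m = 0" if m: "m \<in> {1..N} - insert 1 Q" for m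
    proof (rule ccontr)
      assume "g m \<noteq> 0"
      then have sub: "prime_factors m \<subseteq> P \<union> Q" by (auto simp: g_def split: if_splits)
      have inQ: "l \<in> Q" if "prime l" "l dvd m" for l
      proof -
        have "l \<le> N" using that m by (auto dest!: dvd_imp_le)
        moreover have "l \<in> prime_factors m" using that m by (auto simp: prime_factors_dvd)
        ultimately show ?thesis using sub N(2) by force
      qed
      obtain l where l: "prime l" "l dvd m" using m by (metis DiffE insertCI prime_factor_nat)
      then obtain k where k: "m = l * k" by (auto elim: dvdE)
      have "k \<noteq> 1" using k inQ[OF l] m by auto
      then obtain l' where l': "prime l'" "l' dvd k" by (metis prime_factor_nat)
      have "N < l * l'" using N(3) inQ[OF l] inQ[OF l'(1)] l' k by (simp add: dvd_mult)
      also have "l * l' dvd m" using k l' by simp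
      then have "l * l' \<le> m" using m by (auto dest: dvd_imp_le)
      finally show False using m by simp
    qed
    have Q1: "1 \<notin> Q" using Q(2) by (auto simp: prime_nat_iff)
    have "insert 1 Q \<subseteq> {1..N}" using N(1,4) Q(2) prime_ge_1_nat by auto
    then have "twisted_sum g N \<theta> = (\<Sum>m\<in>insert 1 Q. g m * e (real m * \<theta>))"
      unfolding twisted_sum_def using zero by (intro sum.mono_neutral_right) auto
    also have "\<dots> = g 1 * e (real 1 * \<theta>) + (\<Sum>m\<in>Q. g m * e (real m * \<theta>))"
      using Q1 Q(1) by (subst sum.insert) auto
    also have "g 1 = 1" using mult by (simp add: multiplicative_def)
    also have "(\<Sum>m\<in>Q. g m * e (real m * \<theta>)) = (\<Sum>l\<in>Q. w l * e (real l * \<theta>))"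
      using gQ by (intro sum.cong) auto
    finally show ?thesis by simp
  qed
  then show ?thesis using mult le1 gP by blast
qed

section \<open>A multiplicative function that is large on average\<close>

lemma multiplicative_arch_char: "multiplicative (arch_char u)"
  by (auto simp: multiplicative_def arch_char_def ln_mult cis_mult distrib_left)

lemma norm_arch_char [simp]: "norm (arch_char u n) = 1"
  by (simp add: arch_char_def)

lemma Re_e_ge_half:
  assumes "0 \<le> t" "t \<le> 1 / 8"
  shows "Re (e t) \<ge> 1 / 2"
proof -
  have "Re (e t) = cos (2 * pi * t)" by (simp add: e_def Re_exp mult_ac)
  also have "\<dots> \<ge> cos (pi / 3)"
    using assms by (intro cos_monotone_0_pi_le) (auto simp: field_simps)
  finally show ?thesis by (simp add: cos_60)
qed

text \<open>
  The case in which each \<open>\<theta> p\<close> is close to a fraction \<open>h / r\<close> with \<open>r < \<kappa>\<close>. These points lie, modulo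
  1, in at most \<open>515 * \<kappa> ^ 3\<close> intervals of length \<open>1 / M\<close>, indexed by \<open>r\<close>, by \<open>h mod r\<close> and by the
  position relative to \<open>h / r\<close>. One interval, starting at \<open>\<theta>'\<close>, captures a fair share of the
  points. The phases \<open>l * (\<theta> p - \<theta>')\<close> with \<open>l \<le> X\<close> stay within \<open>1 / 8\<close> modulo 1 there, so the
  function with value \<open>e (- l \<theta>')\<close> at each \<open>l \<in> Q\<close> has sums of order \<open>card Q\<close> at these points. The
  assumption that \<open>card Q\<close> exceeds \<open>\<kappa> ^ 3 * sqrt M\<close>, up to a constant, pays for discarding all other
  points.
\<close>

lemma exists_large_on_major_arcs:
  fixes X M c :: real and \<kappa> :: nat and B P :: "nat set" and N r :: "nat \<Rightarrow> nat" and \<theta> :: "nat \<Rightarrow> real" and h :: "nat \<Rightarrow> int"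
  defines "Q \<equiv> {l::nat. prime l \<and> X / 8 < real l \<and> real l \<le> X}"
  assumes X: "X \<ge> 512" and M: "M = 8 * X"
    and \<kappa>: "\<kappa> \<ge> 1" "real \<kappa> ^ 8 \<le> M" "M \<le> (real \<kappa> + 1) ^ 8"
    and P: "finite P" "\<And>p. p \<in> P \<Longrightarrow> prime p \<and> M < real p"
    and B: "B \<subseteq> P"
    and N: "\<And>p. p \<in> P \<Longrightarrow> X - 1 < real (N p) \<and> real (N p) < M"
    and r: "\<And>p. p \<in> B \<Longrightarrow> 0 < r p \<and> r p < \<kappa>"
    and app: "\<And>p. p \<in> B \<Longrightarrow> \<bar>real (r p) * \<theta> p - of_int (h p)\<bar> \<le> 1 / real \<kappa> ^ 7"
    and card_Q: "real (card Q) \<ge> 4"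
    and large: "c * real \<kappa> ^ 3 * sqrt M \<le> real (card Q)" and c: "c \<ge> 0"
  shows "\<exists>g. multiplicative g \<and> (\<forall>n>0. norm (g n) \<le> 1) \<and> (\<forall>p\<in>P. norm (g p) = 1) \<and>
    c / 2060 * real (card B) * sqrt M \<le> (\<Sum>p\<in>P. norm (twisted_sum g (N p) (\<theta> p)))"
proof -
  have M0: "M > 0" using X M by simp
  \<comment> \<open>The index of the interval modulo 1 that contains \<open>\<theta> p\<close>.\<close>
  define \<phi> where "\<phi> p = (r p, h p mod int (r p), \<lfloor>M * (\<theta> p - of_int (h p) / real (r p))\<rfloor>)" for p
  define Z where "Z = {1..\<kappa>} \<times> {0..<int \<kappa>} \<times> {- 257 * int \<kappa>..257 * int \<kappa>}"
  have finB: "finite B" using B P(1) finite_subset by blast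
  have img: "\<phi> ` B \<subseteq> Z"
  proof
    fix z assume "z \<in> \<phi> ` B"
    then obtain p where p: "p \<in> B" "z = \<phi> p" by auto
    have rp: "0 < r p" "r p < \<kappa>" using r[OF p(1)] by auto
    have "h p mod int (r p) < int (r p)" using rp by simp
    also have "\<dots> < int \<kappa>" using rp by simp
    finally have h: "h p mod int (r p) \<in> {0..<int \<kappa>}" using rp by simp
    have "\<bar>M * (\<theta> p - of_int (h p) / real (r p))\<bar> \<le> 256 * real \<kappa>"
    proof -
      have "\<theta> p - of_int (h p) / real (r p) = (real (r p) * \<theta> p - of_int (h p)) / real (r p)"
        using rp by (simp add: field_simps)
      then have "\<bar>\<theta> p - of_int (h p) / real (r p)\<bar> = \<bar>real (r p) * \<theta> p - of_int (h p)\<bar> / real (r p)"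
        by simp
      also have "\<dots> \<le> \<bar>real (r p) * \<theta> p - of_int (h p)\<bar> / 1"
        using rp by (intro divide_left_mono) auto
      also have "\<dots> \<le> 1 / real \<kappa> ^ 7" using app[OF p(1)] by simp
      finally have "M * \<bar>\<theta> p - of_int (h p) / real (r p)\<bar> \<le> M * (1 / real \<kappa> ^ 7)"
        using M0 by (intro mult_left_mono) auto
      also have "\<dots> \<le> (2 * real \<kappa>) ^ 8 * (1 / real \<kappa> ^ 7)"
      proof (intro mult_right_mono)
        have "(real \<kappa> + 1) ^ 8 \<le> (2 * real \<kappa>) ^ 8" using \<kappa> by (intro power_mono) auto
        then show "M \<le> (2 * real \<kappa>) ^ 8" using \<kappa> by linarith
      qed auto
      also have "\<dots> = 256 * real \<kappa>" using \<kappa> by (simp add: power_mult_distrib field_simps eval_nat_numeral)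
      finally show ?thesis using M0 by (simp add: abs_mult)
    qed
    then have "\<lfloor>M * (\<theta> p - of_int (h p) / real (r p))\<rfloor> \<in> {- 257 * int \<kappa>..257 * int \<kappa>}"
      using \<kappa>(1) by (auto simp: abs_le_iff le_floor_iff floor_le_iff)
    then show "z \<in> Z" using h rp p by (simp add: \<phi>_def Z_def)
  qed
  have cZ: "real (card Z) \<le> 515 * real \<kappa> ^ 3"
  proof -
    have "card Z = \<kappa> * (\<kappa> * nat (514 * int \<kappa> + 1))" by (simp add: Z_def card_cartesian_product)
    then have "real (card Z) = real \<kappa> * (real \<kappa> * (514 * real \<kappa> + 1))" by simp
    also have "\<dots> \<le> real \<kappa> * (real \<kappa> * (515 * real \<kappa>))" using \<kappa> by (intro mult_left_mono) auto
    finally show ?thesis by (simp add: power3_eq_cube)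
  qed
  have "finite Z" "Z \<noteq> {}" using \<kappa>(1) by (auto simp: Z_def)
  then obtain z where "card B \<le> card (\<phi> -` {z} \<inter> B) * card Z"
    using pigeonhole_card[of \<phi> B Z] finB img by blast
  also have "\<phi> -` {z} \<inter> B = {p \<in> B. \<phi> p = z}" by auto
  finally have "real (card B) \<le> real (card {p \<in> B. \<phi> p = z} * card Z)" by (simp only: of_nat_le_iff)
  then have z: "real (card B) \<le> real (card Z) * real (card {p \<in> B. \<phi> p = z})" by (simp add: mult.commute)
  define F where "F = {p \<in> B. \<phi> p = z}"
  obtain q b j where qbj: "z = (q, b, j)" by (cases z) auto
  define \<theta>' where "\<theta>' = of_int b / real q + of_int j / M"
  have finQ: "finite Q" by (rule finite_subset[of _ "{..nat \<lfloor>X\<rfloor>}"]) (auto simp: Q_def le_nat_floor)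
  have "P \<inter> Q = {}" using P(2) M X by (fastforce simp: Q_def)
  then have "\<exists>g. multiplicative g \<and> (\<forall>n>0. norm (g n) \<le> 1) \<and> (\<forall>p\<in>P. norm (g p) = 1) \<and>
    (\<forall>N \<theta>. Q \<subseteq> {..N} \<longrightarrow> (\<forall>p\<in>P. N < p) \<longrightarrow> (\<forall>l\<in>Q. \<forall>l'\<in>Q. N < l * l') \<longrightarrow> N \<ge> 1 \<longrightarrow>
      twisted_sum g N \<theta> = e \<theta> + (\<Sum>l\<in>Q. e (- (real l * \<theta>')) * e (real l * \<theta>)))"
    using P finQ by (intro exists_sparse_multiplicative) (simp_all add: Q_def)
  then obtain g where "multiplicative g \<and> (\<forall>n>0. norm (g n) \<le> 1) \<and> (\<forall>p\<in>P. norm (g p) = 1) \<and>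
    (\<forall>N \<theta>. Q \<subseteq> {..N} \<longrightarrow> (\<forall>p\<in>P. N < p) \<longrightarrow> (\<forall>l\<in>Q. \<forall>l'\<in>Q. N < l * l') \<longrightarrow> N \<ge> 1 \<longrightarrow>
      twisted_sum g N \<theta> = e \<theta> + (\<Sum>l\<in>Q. e (- (real l * \<theta>')) * e (real l * \<theta>)))" ..
  then have g: "multiplicative g" "\<forall>n>0. norm (g n) \<le> 1" "\<forall>p\<in>P. norm (g p) = 1"
    and g_sum: "\<And>N \<theta>. Q \<subseteq> {..N} \<Longrightarrow> (\<And>p. p \<in> P \<Longrightarrow> N < p) \<Longrightarrow> (\<And>l l'. l \<in> Q \<Longrightarrow> l' \<in> Q \<Longrightarrow> N < l * l') \<Longrightarrow>
      N \<ge> 1 \<Longrightarrow> twisted_sum g N \<theta> = e \<theta> + (\<Sum>l\<in>Q. e (- (real l * \<theta>')) * e (real l * \<theta>))"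
    by simp_all
  have S_ge: "norm (twisted_sum g (N p) (\<theta> p)) \<ge> real (card Q) / 4" if p: "p \<in> F" for p
  proof -
    have pB: "p \<in> B" and pP: "p \<in> P" using p B by (auto simp: F_def)
    have rp: "0 < r p" using r[OF pB] by simp
    have q: "q = r p" "b = h p mod int (r p)" "j = \<lfloor>M * (\<theta> p - of_int (h p) / real (r p))\<rfloor>"
      using p qbj by (auto simp: F_def \<phi>_def)
    define d where "d = \<theta> p - of_int (h p) / real (r p) - of_int j / M"
    have d: "0 \<le> d" "d * M \<le> 1"
    proof -
      have "of_int j \<le> M * (\<theta> p - of_int (h p) / real (r p))"
        "M * (\<theta> p - of_int (h p) / real (r p)) < of_int j + 1" unfolding q(3) by linarith+
      moreover have "d * M = M * (\<theta> p - of_int (h p) / real (r p)) - of_int j"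
        using M0 by (simp add: d_def algebra_simps)
      ultimately have "0 \<le> d * M" "d * M \<le> 1" by linarith+
      then show "0 \<le> d" "d * M \<le> 1" using M0 by (simp_all add: zero_le_mult_iff)
    qed
    have "h p = b + int q * (h p div int (r p))" unfolding q(1,2) by simp
    then have "of_int (h p) = of_int b + real q * of_int (h p div int (r p))"
      by (metis of_int_add of_int_mult of_int_of_nat_eq)
    then have "of_int (h p) / real (r p) = of_int b / real q + of_int (h p div int (r p))"
      using rp by (simp add: q(1) add_divide_distrib)
    then have \<theta>p: "\<theta> p = \<theta>' + d + of_int (h p div int (r p))" by (simp add: d_def \<theta>'_def)
    have Np: "X - 1 < real (N p)" "real (N p) < M" using N[OF pP] by auto
    have "twisted_sum g (N p) (\<theta> p) = e (\<theta> p) + (\<Sum>l\<in>Q. e (- (real l * \<theta>')) * e (real l * \<theta> p))"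
    proof (rule g_sum)
      show "Q \<subseteq> {..N p}"
      proof
        fix l assume "l \<in> Q"
        then have "real l < real (N p) + 1" using Np by (auto simp: Q_def)
        then show "l \<in> {..N p}" by simp
      qed
      show "N p < p'" if "p' \<in> P" for p'
        using P(2)[OF that] Np by linarith
      show "N p < l * l'" if "l \<in> Q" "l' \<in> Q" for l l'
      proof -
        have "real (N p) < 8 * X" using Np M by simp
        also have "\<dots> \<le> X / 8 * (X / 8)" using mult_right_mono[of 512 X X] X by simp
        also have "\<dots> \<le> real l * real l'"
          using that X by (intro mult_mono) (auto simp: Q_def)
        finally have "real (N p) < real (l * l')" by simp
        then show ?thesis by (simp only: of_nat_less_iff)
      qed
      show "1 \<le> N p" using Np X by simp
    qed
    also have "(\<Sum>l\<in>Q. e (- (real l * \<theta>')) * e (real l * \<theta> p)) = (\<Sum>l\<in>Q. e (real l * d))"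
    proof (rule sum.cong[OF refl])
      fix l
      have "e (- (real l * \<theta>')) * e (real l * \<theta> p) =
          e (real l * d + of_int (int l * (h p div int (r p))))"
        unfolding \<theta>p by (simp add: e_add[symmetric] algebra_simps)
      then show "e (- (real l * \<theta>')) * e (real l * \<theta> p) = e (real l * d)" by (simp only: e_add_int)
    qed
    finally have eq: "twisted_sum g (N p) (\<theta> p) = e (\<theta> p) + (\<Sum>l\<in>Q. e (real l * d))" .
    have "real (card Q) / 2 = (\<Sum>l\<in>Q. 1 / 2)" by simp
    also have "\<dots> \<le> (\<Sum>l\<in>Q. Re (e (real l * d)))"
    proof (intro sum_mono Re_e_ge_half)
      fix l assume l: "l \<in> Q"
      show "0 \<le> real l * d" using d by simp
      have "real l * d \<le> X * d" using l d by (intro mult_right_mono) (auto simp: Q_def)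
      moreover have "X * d * 8 \<le> 1" using d(2) M by (simp add: algebra_simps)
      ultimately show "real l * d \<le> 1 / 8" by linarith
    qed
    also have "\<dots> = Re (\<Sum>l\<in>Q. e (real l * d))" by simp
    also have "\<dots> \<le> norm (\<Sum>l\<in>Q. e (real l * d))" by (rule complex_Re_le_cmod)
    also have "\<dots> \<le> norm (twisted_sum g (N p) (\<theta> p)) + 1"
      unfolding eq using norm_triangle_ineq4[of "e (\<theta> p) + (\<Sum>l\<in>Q. e (real l * d))" "e (\<theta> p)"] by simp
    finally show ?thesis using card_Q by simp
  qed
  have finF: "finite F" using finB by (simp add: F_def)
  have "real (card B) \<le> 515 * real \<kappa> ^ 3 * real (card F)"
    using z mult_right_mono[OF cZ, of "real (card F)"] by (simp add: F_def)
  then have "c * sqrt M * real (card B) \<le> c * sqrt M * (515 * real \<kappa> ^ 3 * real (card F))"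
    using c M0 by (intro mult_left_mono) auto
  also have "\<dots> = 515 * real (card F) * (c * real \<kappa> ^ 3 * sqrt M)" by simp
  also have "\<dots> \<le> 515 * real (card F) * real (card Q)" using large by (intro mult_left_mono) auto
  finally have "c / 2060 * real (card B) * sqrt M \<le> (\<Sum>p\<in>F. real (card Q) / 4)" by (simp add: mult_ac)
  also have "\<dots> \<le> (\<Sum>p\<in>F. norm (twisted_sum g (N p) (\<theta> p)))" by (intro sum_mono S_ge)
  also have "\<dots> \<le> (\<Sum>p\<in>P. norm (twisted_sum g (N p) (\<theta> p)))"
    using P(1) B by (intro sum_mono2) (auto simp: F_def)
  finally show ?thesis using g by blast
qed

text \<open>
  By Dirichlet's theorem each \<open>\<theta> p\<close> has an approximation with
  denominator \<open>r \<le> \<kappa> ^ 7\<close>. If for at least half of the points \<open>r \<ge> \<kappa>\<close>, a twist \<open>n ^ (i u)\<close> works; otherwise half of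
  the points lie on major arcs. For bounded \<open>X\<close> the function supported on products of primes in \<open>P\<close>
  suffices, since then every twisted sum consists of the term \<open>m = 1\<close> alone.
\<close>

lemma exists_multiplicative_large_on_average:
  "\<exists>c>0. \<forall>(X::real) (P::nat set) (N::nat \<Rightarrow> nat) (\<theta>::nat \<Rightarrow> real).
    X \<ge> 1 \<longrightarrow> finite P \<longrightarrow> (\<forall>p\<in>P. prime p \<and> 8 * X < real p \<and> X - 1 < real (N p) \<and> N p \<ge> 1 \<and> real (N p) < 8 * X) \<longrightarrow>
    (\<exists>g. multiplicative g \<and> (\<forall>n>0. norm (g n) \<le> 1) \<and> (\<forall>p\<in>P. norm (g p) = 1) \<and>
      c * real (card P) * sqrt X \<le> (\<Sum>p\<in>P. norm (twisted_sum g (N p) (\<theta> p))))"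
proof -
  obtain c1 where c1: "c1 > 0"
    and ev: "\<forall>\<^sub>F y::real in at_top. card {p::nat. prime p \<and> y / 8 < p \<and> p \<le> y} \<ge> c1 * y / ln y"
    using card_primes_ge by blast
  have "\<forall>\<^sub>F X::real in at_top. (8 * X) powr (3 / 8) * sqrt (8 * X) \<le> X / ln X"
    by real_asymp
  moreover have "\<forall>\<^sub>F X::real in at_top. 4 \<le> c1 * X / ln X" using c1 by real_asymp
  ultimately have "\<forall>\<^sub>F X::real in at_top. (8 * X) powr (3 / 8) * sqrt (8 * X) \<le> X / ln X \<and>
      4 \<le> c1 * X / ln X \<and> card {p::nat. prime p \<and> X / 8 < p \<and> p \<le> X} \<ge> c1 * X / ln X \<and> X \<ge> 512"
    using ev eventually_ge_at_top[of 512] by eventually_elim auto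
  then obtain X0 :: real where "\<forall>X::real. X \<ge> X0 \<longrightarrow> (8 * X) powr (3 / 8) * sqrt (8 * X) \<le> X / ln X \<and>
      4 \<le> c1 * X / ln X \<and> card {p::nat. prime p \<and> X / 8 < p \<and> p \<le> X} \<ge> c1 * X / ln X \<and> X \<ge> 512"
    unfolding eventually_at_top_linorder ..
  note X0 = this[rule_format]
  have X0_ge: "X0 \<ge> 512" using X0[of X0] by simp
  \<comment> \<open>The three constants belong to bounded \<open>X\<close>, to the twist \<open>n ^ (i u)\<close> and to the major arcs;
    the last two carry a factor \<open>1 / 2\<close> since only half of \<open>P\<close> is used.\<close>
  define c where "c = min (1 / sqrt X0) (min (1 / 2000) (c1 / 4120))"
  have c: "c > 0" "c \<le> 1 / sqrt X0" "c \<le> 1 / 2000" "c \<le> c1 / 4120" using c1 X0_ge by (auto simp: c_def)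
  have "\<exists>g. multiplicative g \<and> (\<forall>n>0. norm (g n) \<le> 1) \<and> (\<forall>p\<in>P. norm (g p) = 1) \<and>
      c * real (card P) * sqrt X \<le> (\<Sum>p\<in>P. norm (twisted_sum g (N p) (\<theta> p)))"
    if X: "X \<ge> 1" and P: "finite P"
      and P': "\<forall>p\<in>P. prime p \<and> 8 * X < real p \<and> X - 1 < real (N p) \<and> N p \<ge> 1 \<and> real (N p) < 8 * X"
    for X :: real and P :: "nat set" and N :: "nat \<Rightarrow> nat" and \<theta> :: "nat \<Rightarrow> real"
  proof (cases "X \<le> X0")
    case True
    have "\<exists>g. multiplicative g \<and> (\<forall>n>0. norm (g n) \<le> 1) \<and> (\<forall>p\<in>P. norm (g p) = 1) \<and>
      (\<forall>N \<theta>. {} \<subseteq> {..N} \<longrightarrow> (\<forall>p\<in>P. N < p) \<longrightarrow> (\<forall>l\<in>{}. \<forall>l'\<in>{}. N < l * l') \<longrightarrow> N \<ge> 1 \<longrightarrow>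
        twisted_sum g N \<theta> = e \<theta> + (\<Sum>l\<in>{}. 1 * e (real l * \<theta>)))"
      using P P' by (intro exists_sparse_multiplicative) simp_all
    then obtain g where "multiplicative g \<and> (\<forall>n>0. norm (g n) \<le> 1) \<and> (\<forall>p\<in>P. norm (g p) = 1) \<and>
      (\<forall>N \<theta>. {} \<subseteq> {..N} \<longrightarrow> (\<forall>p\<in>P. N < p) \<longrightarrow> (\<forall>l\<in>{}. \<forall>l'\<in>{}. N < l * l') \<longrightarrow> N \<ge> 1 \<longrightarrow>
        twisted_sum g N \<theta> = e \<theta> + (\<Sum>l\<in>{}. 1 * e (real l * \<theta>)))" ..
    then have g: "multiplicative g" "\<forall>n>0. norm (g n) \<le> 1" "\<forall>p\<in>P. norm (g p) = 1"
      and g_sum: "\<And>N \<theta>. (\<And>p. p \<in> P \<Longrightarrow> N < p) \<Longrightarrow> N \<ge> 1 \<Longrightarrow> twisted_sum g N \<theta> = e \<theta>"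
      by simp_all
    have "norm (twisted_sum g (N p) (\<theta> p)) = 1" if "p \<in> P" for p
    proof -
      have "N p < p'" if "p' \<in> P" for p'
      proof -
        have "real (N p) < 8 * X" "8 * X < real p'" using P' that \<open>p \<in> P\<close> by simp_all
        then show ?thesis by linarith
      qed
      then have "twisted_sum g (N p) (\<theta> p) = e (\<theta> p)" using P' that by (intro g_sum) auto
      then show ?thesis by simp
    qed
    then have "(\<Sum>p\<in>P. norm (twisted_sum g (N p) (\<theta> p))) = real (card P)" by simp
    moreover have "c * sqrt X \<le> 1"
    proof -
      have "c * sqrt X \<le> 1 / sqrt X0 * sqrt X0" using c True X by (intro mult_mono) auto
      then show ?thesis using X0_ge by simp
    qed
    then have "real (card P) * (c * sqrt X) \<le> real (card P) * 1" by (intro mult_left_mono) auto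
    ultimately show ?thesis using g by (intro exI[of _ g]) (simp add: mult_ac)
  next
    case False
    note big = X0[of X]
    define M where "M = 8 * X"
    have X512: "X \<ge> 512" using big False by simp
    define \<kappa> where "\<kappa> = nat \<lfloor>M powr (1 / 8)\<rfloor>"
    have M1: "M \<ge> 1" "M > 0" using X512 by (simp_all add: M_def)
    have "M powr (1 / 8) \<ge> 1" using M1 by (simp add: ge_one_powr_ge_zero)
    then have \<kappa>1: "\<kappa> \<ge> 1" and \<kappa>_le: "real \<kappa> \<le> M powr (1 / 8)" and \<kappa>_gt: "M powr (1 / 8) < real \<kappa> + 1"
      unfolding \<kappa>_def by linarith+
    have M8: "(M powr (1 / 8)) ^ 8 = M" using M1 by (simp add: powr_power)
    have \<kappa>8: "real \<kappa> ^ 8 \<le> M" using power_mono[OF \<kappa>_le, of 8] M8 by simp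
    have \<kappa>8': "M \<le> (real \<kappa> + 1) ^ 8"
      using power_mono[of "M powr (1/8)" "real \<kappa> + 1" 8] \<kappa>_gt M8 by simp
    have "\<forall>p. \<exists>h r. coprime h (int r) \<and> 0 < r \<and> r \<le> \<kappa> ^ 7 \<and> \<bar>real r * \<theta> p - of_int h\<bar> < 1 / real (\<kappa> ^ 7)"
    proof
      fix p
      obtain h k where hk: "coprime h k" "0 < k" "k \<le> int (\<kappa> ^ 7)" "\<bar>of_int k * \<theta> p - of_int h\<bar> < 1 / real (\<kappa> ^ 7)"
        using Dirichlet_approx_coprime[of "\<kappa> ^ 7" "\<theta> p"] \<kappa>1 by auto
      moreover from hk(2) obtain r where "k = int r" by (auto dest: zero_less_imp_eq_int)
      ultimately show "\<exists>h r. coprime h (int r) \<and> 0 < r \<and> r \<le> \<kappa> ^ 7 \<and> \<bar>real r * \<theta> p - of_int h\<bar> < 1 / real (\<kappa> ^ 7)"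
        by (intro exI[of _ h] exI[of _ r]) (auto simp del: of_nat_power)
    qed
    then obtain h r where hr: "\<And>p. coprime (h p) (int (r p)) \<and> 0 < r p \<and> r p \<le> \<kappa> ^ 7 \<and>
        \<bar>real (r p) * \<theta> p - of_int (h p)\<bar> < 1 / real (\<kappa> ^ 7)"
      by metis
    define G B where "G = {p \<in> P. \<kappa> \<le> r p}" and "B = {p \<in> P. r p < \<kappa>}"
    have "P = G \<union> B" "G \<inter> B = {}" by (auto simp: G_def B_def)
    then have cGB: "card P = card G + card B" using P by (simp add: card_Un_disjoint)
    have sX: "sqrt X \<le> sqrt M" using X by (simp add: M_def)
    show ?thesis
    proof (cases "card P \<le> 2 * card G")
      case True
      have "\<exists>u. real (card G) * sqrt M / 1000 \<le> (\<Sum>p\<in>G. norm (twisted_sum (arch_char u) (N p) (\<theta> p)))"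
      proof (rule exists_arch_char_large)
        show "finite G" using P by (simp add: G_def)
        fix p assume p: "p \<in> G"
        then have Np: "X - 1 < real (N p)" "N p \<ge> 1" "real (N p) < M" using P' by (auto simp: G_def M_def)
        then show "1 \<le> N p \<and> M / 9 \<le> real (N p) \<and> real (N p) \<le> M" using X512 by (simp add: M_def)
        have app: "\<bar>real (r p) * \<theta> p - of_int (h p)\<bar> \<le> 1 / real (r p)"
        proof -
          have "real (r p) \<le> real (\<kappa> ^ 7)" using hr[of p] by (simp only: of_nat_le_iff)
          then have "1 / real (\<kappa> ^ 7) \<le> 1 / real (r p)" using hr[of p] \<kappa>1 by (intro divide_left_mono) auto
          then show ?thesis using hr[of p] by linarith
        qed
        have "(\<Sum>(b, c)\<in>coprime_pairs (N p). (norm (dirichlet_sum (N p div max b c) ((real b - real c) * \<theta> p)))\<^sup>2)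
            \<le> (real (N p))\<^sup>2 + 2 * (\<Sum>b=1..N p. \<Sum>k=1..<b. (norm (dirichlet_sum (N p div b) (real k * \<theta> p)))\<^sup>2)"
          by (rule sum_coprime_pairs_le)
        also have "\<dots> \<le> M\<^sup>2 + 2 * (336 * M\<^sup>2)"
          using hr[of p] app p Np \<kappa>1 \<kappa>8 \<kappa>8'
          by (intro add_mono mult_left_mono power_mono double_sum_dirichlet_le[of "h p" "r p" _ \<kappa>]) (auto simp: G_def)
        finally show "(\<Sum>(b, c)\<in>coprime_pairs (N p).
            (norm (dirichlet_sum (N p div max b c) ((real b - real c) * \<theta> p)))\<^sup>2) \<le> 673 * M\<^sup>2" by simp
      qed (use M1 in auto)
      then obtain u where u: "real (card G) * sqrt M / 1000 \<le> (\<Sum>p\<in>G. norm (twisted_sum (arch_char u) (N p) (\<theta> p)))" by blast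
      have "c * real (card P) * sqrt X \<le> (1 / 2000) * real (2 * card G) * sqrt M"
        using c True sX X by (intro mult_mono) (auto simp del: of_nat_mult)
      also have "\<dots> = real (card G) * sqrt M / 1000" by simp
      also note u
      also have "(\<Sum>p\<in>G. norm (twisted_sum (arch_char u) (N p) (\<theta> p))) \<le> (\<Sum>p\<in>P. norm (twisted_sum (arch_char u) (N p) (\<theta> p)))"
        using P by (intro sum_mono2) (auto simp: G_def)
      finally show ?thesis using multiplicative_arch_char by (intro exI[of _ "arch_char u"]) simp
    next
      case False
      let ?Q = "{l::nat. prime l \<and> X / 8 < real l \<and> real l \<le> X}"
      have "real \<kappa> ^ 3 \<le> (M powr (1 / 8)) ^ 3" using \<kappa>_le by (intro power_mono) auto
      also have "\<dots> = M powr (3 / 8)" using M1 by (simp add: powr_power)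
      finally have "c1 * (real \<kappa> ^ 3 * sqrt M) \<le> c1 * (M powr (3 / 8) * sqrt M)"
        using c1 M1 by (intro mult_left_mono mult_right_mono) auto
      also have "\<dots> \<le> c1 * (X / ln X)" using big \<open>\<not> X \<le> X0\<close> c1 by (intro mult_left_mono) (auto simp: M_def)
      also have "\<dots> \<le> real (card ?Q)" using big \<open>\<not> X \<le> X0\<close> by simp
      finally have large: "c1 * real \<kappa> ^ 3 * sqrt M \<le> real (card ?Q)" by (simp add: mult_ac)
      have cQ: "real (card ?Q) \<ge> 4" using big \<open>\<not> X \<le> X0\<close> by linarith
      have "\<exists>g. multiplicative g \<and> (\<forall>n>0. norm (g n) \<le> 1) \<and> (\<forall>p\<in>P. norm (g p) = 1) \<and>
          c1 / 2060 * real (card B) * sqrt M \<le> (\<Sum>p\<in>P. norm (twisted_sum g (N p) (\<theta> p)))"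
      proof (rule exists_large_on_major_arcs[where X = X and \<kappa> = \<kappa> and r = r and h = h])
        show "\<bar>real (r p) * \<theta> p - of_int (h p)\<bar> \<le> 1 / real \<kappa> ^ 7" for p using hr[of p] by simp
      qed (use X512 M_def \<kappa>1 \<kappa>8 \<kappa>8' P P' hr cQ large c1 in \<open>auto simp: B_def\<close>)
      then obtain g where g: "multiplicative g" "\<forall>n>0. norm (g n) \<le> 1" "\<forall>p\<in>P. norm (g p) = 1"
        and gs: "c1 / 2060 * real (card B) * sqrt M \<le> (\<Sum>p\<in>P. norm (twisted_sum g (N p) (\<theta> p)))" by blast
      have "c * real (card P) * sqrt X \<le> (c1 / 4120) * real (2 * card B) * sqrt M"
        using c False cGB sX X c1 by (intro mult_mono) (auto simp del: of_nat_mult)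
      also have "\<dots> = c1 / 2060 * real (card B) * sqrt M" by simp
      finally show ?thesis using g gs by (intro exI[of _ g]) auto
    qed
  qed
  then show ?thesis using c(1) by blast
qed

section \<open>The lower bound\<close>

theorem proposition1p1:
  fixes \<epsilon> :: real
  assumes "0 < \<epsilon>" and "\<epsilon> < 1 / 10"
  shows "\<exists>c>0. \<forall>\<^sub>F x::real in at_top.
    \<forall>(y::real) (q::nat) (a::int) (\<alpha>::real).
      x * exp (- (1 / 2 - \<epsilon>) * sqrt (ln x)) \<le> y \<longrightarrow> y \<le> x \<longrightarrow>
      q > 0 \<longrightarrow>
      (x^2 / y^2 * ln x powr (3 / 2)) powr (1 + \<epsilon>) \<le> real q \<longrightarrow>
      real q \<le> x * exp (- (3 / 2) * sqrt (ln x)) \<longrightarrow>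
      coprime a (int q) \<longrightarrow> \<alpha> = of_int a / of_nat q \<longrightarrow>
      (\<exists>f. multiplicative f \<and> (\<forall>n>0. f n \<in> unit_disc) \<and>
        norm (\<Sum>n | n > 0 \<and> real n \<le> x \<and> real (largest_prime_factor n) \<le> y.
                f n * e (real n * \<alpha>)) \<ge> c * (sqrt (x * y) / ln x))"
proof -
  obtain c1 where c1: "c1 > 0"
    and ev: "\<forall>\<^sub>F y::real in at_top. card {p::nat. prime p \<and> y / 8 < p \<and> p \<le> y} \<ge> c1 * y / ln y"
    using card_primes_ge by blast
  obtain c2 :: real where "c2 > 0 \<and> (\<forall>(X::real) (P::nat set) (N::nat \<Rightarrow> nat) (\<theta>::nat \<Rightarrow> real).
    X \<ge> 1 \<longrightarrow> finite P \<longrightarrow> (\<forall>p\<in>P. prime p \<and> 8 * X < real p \<and> X - 1 < real (N p) \<and> N p \<ge> 1 \<and> real (N p) < 8 * X) \<longrightarrow>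
    (\<exists>g. multiplicative g \<and> (\<forall>n>0. norm (g n) \<le> 1) \<and> (\<forall>p\<in>P. norm (g p) = 1) \<and>
      c2 * real (card P) * sqrt X \<le> (\<Sum>p\<in>P. norm (twisted_sum g (N p) (\<theta> p)))))"
    using exists_multiplicative_large_on_average ..
  then have c2: "c2 > 0" and avg: "\<And>(X::real) (P::nat set) (N::nat \<Rightarrow> nat) (\<theta>::nat \<Rightarrow> real).
    X \<ge> 1 \<Longrightarrow> finite P \<Longrightarrow>
    (\<And>p. p \<in> P \<Longrightarrow> prime p \<and> 8 * X < real p \<and> X - 1 < real (N p) \<and> N p \<ge> 1 \<and> real (N p) < 8 * X) \<Longrightarrow>
    \<exists>g. multiplicative g \<and> (\<forall>n>0. norm (g n) \<le> 1) \<and> (\<forall>p\<in>P. norm (g p) = 1) \<and>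
      c2 * real (card P) * sqrt X \<le> (\<Sum>p\<in>P. norm (twisted_sum g (N p) (\<theta> p)))"
    by simp_all
  obtain y0 :: real where "\<forall>y::real. y \<ge> y0 \<longrightarrow> card {p::nat. prime p \<and> y / 8 < p \<and> p \<le> y} \<ge> c1 * y / ln y"
    using ev unfolding eventually_at_top_linorder ..
  note y0 = this[rule_format]
  \<comment> \<open>These bounds give \<open>y \<ge> x powr (3 / 4)\<close> and hence \<open>y * y > 64 * x\<close>, so that the cofactors
    \<open>x / p < 8 * (x / y)\<close> are smaller than every prime \<open>p > y / 8\<close>.\<close>
  have "\<forall>\<^sub>F x::real in at_top. x * exp (- (1 / 2) * sqrt (ln x)) \<ge> x powr (3 / 4)" by real_asymp
  moreover have "\<forall>\<^sub>F x::real in at_top. x powr (3 / 4) \<ge> max y0 2" by real_asymp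
  moreover have "\<forall>\<^sub>F x::real in at_top. (x powr (3 / 4))\<^sup>2 > 64 * x" by real_asymp
  ultimately have large: "\<forall>\<^sub>F x::real in at_top. x * exp (- (1 / 2) * sqrt (ln x)) \<ge> x powr (3 / 4) \<and>
      x powr (3 / 4) \<ge> max y0 2 \<and> (x powr (3 / 4))\<^sup>2 > 64 * x \<and> x \<ge> 2"
    using eventually_ge_at_top[of 2] by eventually_elim auto
  show ?thesis
  proof (intro exI[of _ "c1 * c2"] conjI eventually_mono[OF large] allI impI)
    show "c1 * c2 > 0" using c1 c2 by simp
    fix x y \<alpha> :: real and q :: nat and a :: int
    assume x: "x * exp (- (1 / 2) * sqrt (ln x)) \<ge> x powr (3 / 4) \<and>
        x powr (3 / 4) \<ge> max y0 2 \<and> (x powr (3 / 4))\<^sup>2 > 64 * x \<and> x \<ge> 2"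
      and xy: "x * exp (- (1 / 2 - \<epsilon>) * sqrt (ln x)) \<le> y" and yx: "y \<le> x"
    have "x powr (3 / 4) \<le> x * exp (- (1 / 2) * sqrt (ln x))" using x by simp
    also have "- (1 / 2) * sqrt (ln x) \<le> - (1 / 2 - \<epsilon>) * sqrt (ln x)"
      using x assms(1) by (intro mult_right_mono) auto
    then have "x * exp (- (1 / 2) * sqrt (ln x)) \<le> x * exp (- (1 / 2 - \<epsilon>) * sqrt (ln x))"
      using x by (intro mult_left_mono) auto
    also note xy
    finally have y34: "x powr (3 / 4) \<le> y" .
    then have "(x powr (3 / 4))\<^sup>2 \<le> y\<^sup>2" by (intro power_mono) auto
    then have yy: "64 * x < y * y" using x by (simp add: power2_eq_square)
    have y: "y \<ge> y0" "y \<ge> 2" using x y34 by auto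
    define P where "P = {p::nat. prime p \<and> y / 8 < p \<and> p \<le> y}"
    define X where "X = x / y"
    define N where "N p = nat \<lfloor>x / real p\<rfloor>" for p :: nat
    have X: "X \<ge> 1" "8 * X < y / 8" using y yx yy by (simp_all add: X_def field_simps)
    have finP: "finite P" by (rule finite_subset[of _ "{..nat \<lfloor>y\<rfloor>}"]) (auto simp: P_def le_nat_floor)
    have range: "X \<le> x / real p" "x / real p < 8 * X" if "p \<in> P" for p
    proof -
      have p: "y / 8 < real p" "real p \<le> y" "real p > 0" using that y by (auto simp: P_def)
      show "X \<le> x / real p" unfolding X_def using p x y by (intro divide_left_mono) auto
      have "x / real p < x / (y / 8)" using p x y by (intro divide_strict_left_mono) auto
      then show "x / real p < 8 * X" by (simp add: X_def mult.commute)
    qed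
    have "prime p \<and> 8 * X < real p \<and> X - 1 < real (N p) \<and> N p \<ge> 1 \<and> real (N p) < 8 * X" if "p \<in> P" for p
    proof -
      have "x / real p \<ge> 1" using range[OF that] X by simp
      then have "x / real p - 1 < real (N p)" "real (N p) \<le> x / real p" "N p \<ge> 1"
        unfolding N_def by linarith+
      then show ?thesis using range[OF that] X that by (auto simp: P_def)
    qed
    then have "\<exists>g. multiplicative g \<and> (\<forall>n>0. norm (g n) \<le> 1) \<and> (\<forall>p\<in>P. norm (g p) = 1) \<and>
      c2 * real (card P) * sqrt X \<le> (\<Sum>p\<in>P. norm (twisted_sum g (N p) (real p * \<alpha>)))"
      by (intro avg X(1) finP)
    then obtain g where g: "multiplicative g" "\<forall>n>0. norm (g n) \<le> 1" "\<forall>p\<in>P. norm (g p) = 1"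
      and gs: "c2 * real (card P) * sqrt X \<le> (\<Sum>p\<in>P. norm (twisted_sum g (N p) (real p * \<alpha>)))"
      by blast
    have L: "y / 8 \<le> real p \<and> real p \<le> y \<and> x / real p < y / 8" if "p \<in> P" for p
    proof (intro conjI)
      show "x / real p < y / 8" using range[OF that] X(2) by linarith
    qed (use that in \<open>auto simp: P_def\<close>)
    have "\<exists>f. multiplicative f \<and> (\<forall>n>0. f n \<in> unit_disc) \<and>
      (\<Sum>p\<in>P. norm (twisted_sum g (nat \<lfloor>x / real p\<rfloor>) (real p * \<alpha>)))
      \<le> norm (\<Sum>n | n > 0 \<and> real n \<le> x \<and> real (largest_prime_factor n) \<le> y. f n * e (real n * \<alpha>))"
    proof (rule exists_aligned_multiplicative[where L = "y / 8"])
      show "0 \<le> x" using x by simp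
      show "prime p" if "p \<in> P" for p using that by (simp add: P_def)
      show "norm (g n) \<le> 1" if "n > 0" for n using that g(2) by blast
      show "norm (g p) = 1" if "p \<in> P" for p using that g(3) by blast
    qed (fact g(1), fact finP, fact L)
    then obtain f where f: "multiplicative f" "\<forall>n>0. f n \<in> unit_disc"
      and fs: "(\<Sum>p\<in>P. norm (twisted_sum g (N p) (real p * \<alpha>)))
      \<le> norm (\<Sum>n | n > 0 \<and> real n \<le> x \<and> real (largest_prime_factor n) \<le> y. f n * e (real n * \<alpha>))"
      unfolding N_def by blast
    have "c1 * c2 * (sqrt (x * y) / ln x) = c2 * (c1 * y / ln x) * sqrt X"
    proof -
      have "sqrt (x * y) = sqrt (y\<^sup>2 * X)" using y by (simp add: X_def power2_eq_square mult.commute)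
      also have "\<dots> = y * sqrt X" using y by (simp add: real_sqrt_mult)
      finally show ?thesis by simp
    qed
    also have "\<dots> \<le> c2 * real (card P) * sqrt X"
    proof (intro mult_right_mono mult_left_mono)
      have "c1 * y / ln x \<le> c1 * y / ln y"
        using y yx c1 by (intro divide_left_mono) (auto simp: ln_mono)
      also have "\<dots> \<le> real (card P)" using y0[OF y(1)] by (simp add: P_def)
      finally show "c1 * y / ln x \<le> real (card P)" .
    qed (use c2 X in auto)
    also note gs
    also note fs
    finally show "\<exists>f. multiplicative f \<and> (\<forall>n>0. f n \<in> unit_disc) \<and>
        norm (\<Sum>n | n > 0 \<and> real n \<le> x \<and> real (largest_prime_factor n) \<le> y.
                f n * e (real n * \<alpha>)) \<ge> c1 * c2 * (sqrt (x * y) / ln x)"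
      using f by blast
  qed
qed

end
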